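(* Suppose $L|K$ satisfies (II) and has defect. Let $\mathscr{S}=\{\alpha\in L\mid \alpha^p-\alpha=f \text{ for some } f\in K, \text{ and } \alpha \text{ generates } L|K\}$. For each $\alpha\in\mathscr{S}$ one can find $\alpha'\in B^\times\cap\alpha K^\times$ such that $B=\bigcup_{\alpha\in\mathscr{S}}A[\alpha']$ is a filtered union, that is: (i) for any $\alpha_1,\alpha_2\in\mathscr{S}$, either $A[\alpha_1']\subset A[\alpha_2']$ or $A[\alpha_2']\subset A[\alpha_1']$; (ii) given any $\beta\in B$, there exists $\alpha\in\mathscr{S}$ such that $\beta\in A[\alpha']$.
   Context: Let $K$ be a valued field of characteristic $p>0$ with henselian valuation ring $A$, valuation $v_K$, residue field $k$ and value group $\Gamma$. Let $L|K$ be an Artin–Schreier extension of degree $p$, i.e. $L=K(\alpha)$ with $\alpha^p-\alpha\in K^\times$ and $[L:K]=p$. Let $B$ be the integral closure of $A$ in $L$ (a valuation ring), $v_L$ the extension of $v_K$ to $L$, $l$ the residue field of $L$. Condition (II): $\Gamma$ is isomorphic to a subgroup of $\mathbb{R}$ as an ordered group. $L|K$ has defect means $(v_L(L^\times):v_K(K^\times))\cdot[l:k]\neq p$; equivalently $v_L(L^\times)=v_K(K^\times)$ and $l=k$. *)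

theory Defs
  imports "HOL-Algebra.Algebra" "HOL-Algebra.Algebraic_Closure_Type"
begin

text \<open>
  The ambient field \<open>L\<close> is a type \<open>'a::field\<close>, and its subfields and subrings are sets.
  The ring record \<open>ring_of_type_algebra\<close> gives access to the notions of \<open>HOL-Algebra\<close>;
  polynomials are those of type \<open>'a poly\<close>.
\<close>

abbreviation ambient :: "'a::field ring"
  where "ambient \<equiv> ring_of_type_algebra"


subsection \<open>Valuations\<close>

text \<open>
  Additive valuations on a subfield \<open>F\<close>. There is no value \<open>\<infinity>\<close>: only the values at the non-zero
  elements of \<open>F\<close> matter, and \<open>v 0\<close> is arbitrary.
\<close>

definition valuation_on :: "'a::field set \<Rightarrow> ('a \<Rightarrow> 'g::linordered_ab_group_add) \<Rightarrow> bool"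
  where "valuation_on F v \<longleftrightarrow>
    (\<forall>x\<in>F - {0}. \<forall>y\<in>F - {0}. v (x * y) = v x + v y) \<and>
    (\<forall>x\<in>F - {0}. \<forall>y\<in>F - {0}. x + y \<noteq> 0 \<longrightarrow> min (v x) (v y) \<le> v (x + y))"

definition value_group :: "'a::field set \<Rightarrow> ('a \<Rightarrow> 'g) \<Rightarrow> 'g set"
  where "value_group F v = v ` (F - {0})"

definition valuation_ring :: "'a::field set \<Rightarrow> ('a \<Rightarrow> 'g::linordered_ab_group_add) \<Rightarrow> 'a set"
  where "valuation_ring F v = {x \<in> F. x = 0 \<or> 0 \<le> v x}"

definition valuation_ideal :: "'a::field set \<Rightarrow> ('a \<Rightarrow> 'g::linordered_ab_group_add) \<Rightarrow> 'a set"
  where "valuation_ideal F v = {x \<in> F. x = 0 \<or> 0 < v x}"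

definition residue_field ::
    "'a::field set \<Rightarrow> ('a \<Rightarrow> 'g::linordered_ab_group_add) \<Rightarrow> 'a set ring"
  where "residue_field F v = ambient\<lparr>carrier := valuation_ring F v\<rparr> Quot valuation_ideal F v"

text \<open>
  Hensel's lemma: a monic polynomial over the valuation ring whose reduction has a simple root in
  the residue field has a root in the valuation ring lifting it. The root of the reduction is
  given by a representative \<open>a\<close>.
\<close>

definition henselian :: "'a::field set \<Rightarrow> ('a \<Rightarrow> 'g::linordered_ab_group_add) \<Rightarrow> bool"
  where "henselian F v \<longleftrightarrow>
    (\<forall>f :: 'a poly. \<forall>a \<in> valuation_ring F v.
       Polynomial.lead_coeff f = 1 \<and> (\<forall>i. poly.coeff f i \<in> valuation_ring F v) \<and>
       poly f a \<in> valuation_ideal F v \<and> poly (pderiv f) a \<notin> valuation_ideal F v \<longrightarrow>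
       (\<exists>b \<in> valuation_ring F v. poly f b = 0 \<and> b - a \<in> valuation_ideal F v))"

text \<open>
  An order embedding of \<open>\<Gamma>\<close> into the reals is an isomorphism of ordered groups from \<open>\<Gamma>\<close> onto its
  image, which is a subgroup.
\<close>

definition embeds_in_reals :: "'g::linordered_ab_group_add set \<Rightarrow> bool"
  where "embeds_in_reals \<Gamma> \<longleftrightarrow>
    (\<exists>h :: 'g \<Rightarrow> real. (\<forall>x\<in>\<Gamma>. \<forall>y\<in>\<Gamma>. h (x + y) = h x + h y) \<and> strict_mono_on \<Gamma> h)"


subsection \<open>Extensions of valued fields\<close>

text \<open>
  Here \<open>L\<close> is the whole type, \<open>v\<^sub>L\<close> is a valuation on it and \<open>v\<^sub>K\<close> is its restriction to \<open>K\<close>.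
\<close>

definition extends_valuation ::
    "'a::field set \<Rightarrow> ('a \<Rightarrow> 'g::linordered_ab_group_add) \<Rightarrow> ('a \<Rightarrow> 'g) \<Rightarrow> bool"
  where "extends_valuation K v\<^sub>K v\<^sub>L \<longleftrightarrow>
    valuation_on UNIV v\<^sub>L \<and> (\<forall>x\<in>K - {0}. v\<^sub>L x = v\<^sub>K x)"

definition integral_closure :: "'a::field set \<Rightarrow> 'a set"
  where "integral_closure A =
    {x. \<exists>f :: 'a poly. Polynomial.lead_coeff f = 1 \<and> (\<forall>i. poly.coeff f i \<in> A) \<and> poly f x = 0}"

definition ramification_index ::
    "'a::field set \<Rightarrow> ('a \<Rightarrow> 'g::linordered_ab_group_add) \<Rightarrow> ('a \<Rightarrow> 'g) \<Rightarrow> nat"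
  where "ramification_index K v\<^sub>K v\<^sub>L =
    card (rcosets\<^bsub>\<lparr>carrier = value_group UNIV v\<^sub>L, monoid.mult = (+), one = 0\<rparr>\<^esub> (value_group K v\<^sub>K))"

text \<open>The image of the residue field of \<open>K\<close> under its canonical embedding into that of \<open>L\<close>.\<close>

definition base_residues ::
    "'a::field set \<Rightarrow> ('a \<Rightarrow> 'g::linordered_ab_group_add) \<Rightarrow> ('a \<Rightarrow> 'g) \<Rightarrow> 'a set set"
  where "base_residues K v\<^sub>K v\<^sub>L =
    (\<lambda>a. valuation_ideal UNIV v\<^sub>L +>\<^bsub>ambient\<lparr>carrier := valuation_ring UNIV v\<^sub>L\<rparr>\<^esub> a)
      ` valuation_ring K v\<^sub>K"

definition residue_degree ::
    "'a::field set \<Rightarrow> ('a \<Rightarrow> 'g::linordered_ab_group_add) \<Rightarrow> ('a \<Rightarrow> 'g) \<Rightarrow> nat"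
  where "residue_degree K v\<^sub>K v\<^sub>L =
    ring.dim (residue_field UNIV v\<^sub>L) (base_residues K v\<^sub>K v\<^sub>L) (carrier (residue_field UNIV v\<^sub>L))"

text \<open>
  For \<open>[L : K] = p\<close>, the index and the degree are finite by the fundamental inequality, so the
  values that \<open>card\<close> and \<open>ring.dim\<close> take in the infinite case do not occur.
\<close>

definition has_defect ::
    "nat \<Rightarrow> 'a::field set \<Rightarrow> ('a \<Rightarrow> 'g::linordered_ab_group_add) \<Rightarrow> ('a \<Rightarrow> 'g) \<Rightarrow> bool"
  where "has_defect p K v\<^sub>K v\<^sub>L \<longleftrightarrow> ramification_index K v\<^sub>K v\<^sub>L * residue_degree K v\<^sub>K v\<^sub>L \<noteq> p"


subsection \<open>Artin--Schreier extensions\<close>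

definition generates :: "'a::field set \<Rightarrow> 'a \<Rightarrow> bool"
  where "generates K \<alpha> \<longleftrightarrow> generate_field ambient (insert \<alpha> K) = UNIV"

definition artin_schreier :: "nat \<Rightarrow> 'a::field set \<Rightarrow> bool"
  where "artin_schreier p K \<longleftrightarrow>
    ring.dimension ambient p K UNIV \<and> (\<exists>\<alpha>. \<alpha> ^ p - \<alpha> \<in> K - {0} \<and> generates K \<alpha>)"

definition AS_generators :: "nat \<Rightarrow> 'a::field set \<Rightarrow> 'a set"
  where "AS_generators p K = {\<alpha>. (\<exists>f\<in>K. \<alpha> ^ p - \<alpha> = f) \<and> generates K \<alpha>}"

definition adjoin :: "'a::field set \<Rightarrow> 'a \<Rightarrow> 'a set"
  where "adjoin A x = ring.simple_extension ambient A x"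

end

theory Submission
  imports Defs "Jordan_Normal_Form.Char_Poly" "HOL-Number_Theory.Cong"
begin

text \<open>
  Let \<open>\<O>\<close> be the valuation ring of \<open>L\<close> and \<open>A = \<O> \<inter> K\<close>. For a generator \<open>\<alpha>\<close> choose \<open>t \<in> K\<close> with
  \<open>v t = - v \<alpha>\<close>, so that \<open>\<alpha>' = t\<alpha>\<close> is a unit of \<open>\<O>\<close>. Any two generators satisfy \<open>\<alpha> = i\<beta> + c\<close> with
  \<open>0 < i < p\<close> and \<open>c \<in> K\<close> (\<open>generators_related\<close>). Hence if \<open>v \<alpha> \<le> v \<beta>\<close>, then \<open>\<alpha>'\<close> is a polynomial of degree
  one in \<open>\<beta>'\<close> with coefficients in \<open>A\<close>, and \<open>A[\<alpha>'] \<subseteq> A[\<beta>']\<close> (\<open>prim_chain\<close>). The ring \<open>A[\<alpha>']\<close> thus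
  grows as \<open>\<alpha>\<close> is replaced by \<open>\<alpha> - c\<close> for better approximations \<open>c \<in> K\<close> of \<open>\<alpha>\<close>.

  The defect enters through the fact that \<open>\<alpha>\<close> has no best approximation in \<open>K\<close>
  (\<open>defect_no_best_approximation\<close>). Suppose that \<open>v (\<alpha> - c)\<close> is maximal for \<open>c = 0\<close>. If \<open>v \<alpha>\<close> is not in
  the value group of \<open>K\<close>, the powers of \<open>\<alpha>\<close> below the \<open>p\<close>-th have values in different cosets of it,
  and \<open>e = p\<close>, \<open>f = 1\<close>. If it is, the residue of \<open>\<alpha>'\<close> is not in the residue field \<open>k\<close> of \<open>K\<close>; as \<open>\<alpha>'\<close> is a root of
  \<open>X\<^sup>p - t\<^bsup>p-1\<^esup>X - b\<close> with \<open>t, b \<in> A\<close>, the powers of its residue below the \<open>p\<close>-th are independent over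
  \<open>k\<close> (\<open>powers_independent\<close>), and \<open>e = 1\<close>, \<open>f = p\<close>. In both cases there is no defect.

  It remains to place each \<open>x \<in> \<O>\<close> in some \<open>A[(\<alpha> - c)']\<close> (\<open>mem_adjoin_prim\<close>). Write \<open>x = P(\<alpha>)\<close> with
  \<open>P\<close> of degree below \<open>p\<close>, and expand around \<open>c \<in> K\<close>: \<open>x = \<Sum> H\<^sub>k(c) (\<alpha> - c)\<^sup>k\<close>. By a lemma in the spirit of
  Ostrowski and Kaplansky (\<open>eventually_value_constant\<close>), for \<open>c\<close> close to \<open>\<alpha>\<close> the term \<open>P(c)\<close> has a
  smaller value than all others. Then it has the value of \<open>x\<close>, all terms lie in \<open>\<O>\<close>, and each is an
  element of \<open>A\<close> times a power of \<open>(\<alpha> - c)'\<close>. The lemma uses that \<open>K\<close> is henselian: a polynomial whose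
  values keep growing near \<open>\<alpha>\<close> must have a root in \<open>K\<close>, which can be split off.

  Finally \<open>v \<alpha> \<le> 0\<close> for each generator, again by Hensel's lemma, so the equation of \<open>\<alpha>'\<close> has
  coefficients in \<open>A\<close> and \<open>A[\<alpha>']\<close> is integral over \<open>A\<close>. This identifies \<open>\<O>\<close> with the integral closure.
\<close>

section \<open>Polynomials over a subring\<close>

definition polys_over :: "'a::field set \<Rightarrow> 'a poly set" where
  "polys_over R = {P. \<forall>i. poly.coeff P i \<in> R}"

lemma polys_overI: "(\<And>i. poly.coeff P i \<in> R) \<Longrightarrow> P \<in> polys_over R"
  by (simp add: polys_over_def)

lemma polys_overD: "P \<in> polys_over R \<Longrightarrow> poly.coeff P i \<in> R"
  by (simp add: polys_over_def)

lemma polys_over_mono: "R \<subseteq> R' \<Longrightarrow> polys_over R \<subseteq> polys_over R'"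
  by (auto simp: polys_over_def)

locale subring_set =
  fixes R :: "'a::field set"
  assumes one_mem: "1 \<in> R"
    and diff_mem: "x \<in> R \<Longrightarrow> y \<in> R \<Longrightarrow> x - y \<in> R"
    and mult_mem: "x \<in> R \<Longrightarrow> y \<in> R \<Longrightarrow> x * y \<in> R"
begin

lemma zero_mem: "0 \<in> R"
  using diff_mem[OF one_mem one_mem] by simp

lemma uminus_mem: "x \<in> R \<Longrightarrow> - x \<in> R"
  using diff_mem[OF zero_mem] by simp

lemma add_mem: "x \<in> R \<Longrightarrow> y \<in> R \<Longrightarrow> x + y \<in> R"
  using diff_mem[OF _ uminus_mem] by fastforce

lemma power_mem: "x \<in> R \<Longrightarrow> x ^ n \<in> R"
  by (induction n) (auto intro: one_mem mult_mem)

lemma of_nat_mem: "of_nat n \<in> R"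
  by (induction n) (auto intro: one_mem zero_mem add_mem)

lemma sum_mem: "(\<And>i. i \<in> S \<Longrightarrow> f i \<in> R) \<Longrightarrow> sum f S \<in> R"
  by (induction S rule: infinite_finite_induct) (auto intro: zero_mem add_mem)

lemma prod_mem: "(\<And>i. i \<in> S \<Longrightarrow> f i \<in> R) \<Longrightarrow> prod f S \<in> R"
  by (induction S rule: infinite_finite_induct) (auto intro: one_mem mult_mem)

lemmas subring_mems = one_mem zero_mem diff_mem mult_mem uminus_mem add_mem power_mem of_nat_mem
  sum_mem prod_mem

lemma poly_mem: "P \<in> polys_over R \<Longrightarrow> x \<in> R \<Longrightarrow> poly P x \<in> R"
  unfolding poly_altdef by (intro subring_mems) (auto dest: polys_overD)

lemma polys_over_pCons_iff: "pCons a P \<in> polys_over R \<longleftrightarrow> a \<in> R \<and> P \<in> polys_over R"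
proof
  assume *: "pCons a P \<in> polys_over R"
  show "a \<in> R \<and> P \<in> polys_over R"
    using polys_overD[OF *, of 0] polys_overD[OF *, of "Suc _"] by (auto intro: polys_overI)
qed (auto simp: polys_over_def coeff_pCons split: nat.split)

lemma zero_polys_over: "0 \<in> polys_over R"
  by (simp add: polys_over_def zero_mem)

lemma one_polys_over: "1 \<in> polys_over R"
  by (simp add: polys_over_def zero_mem one_mem)

lemma diff_polys_over: "P \<in> polys_over R \<Longrightarrow> Q \<in> polys_over R \<Longrightarrow> P - Q \<in> polys_over R"
  by (simp add: polys_over_def diff_mem)

lemma add_polys_over: "P \<in> polys_over R \<Longrightarrow> Q \<in> polys_over R \<Longrightarrow> P + Q \<in> polys_over R"
  by (simp add: polys_over_def add_mem)

lemma uminus_polys_over: "P \<in> polys_over R \<Longrightarrow> - P \<in> polys_over R"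
  by (simp add: polys_over_def uminus_mem)

lemma smult_polys_over: "a \<in> R \<Longrightarrow> P \<in> polys_over R \<Longrightarrow> Polynomial.smult a P \<in> polys_over R"
  by (simp add: polys_over_def mult_mem)

lemma mult_polys_over: "P \<in> polys_over R \<Longrightarrow> Q \<in> polys_over R \<Longrightarrow> P * Q \<in> polys_over R"
  by (simp add: polys_over_def Polynomial.coeff_mult sum_mem mult_mem)

lemma monom_polys_over: "a \<in> R \<Longrightarrow> Polynomial.monom a n \<in> polys_over R"
  by (simp add: polys_over_def zero_mem)

lemma sum_polys_over: "(\<And>i. i \<in> S \<Longrightarrow> f i \<in> polys_over R) \<Longrightarrow> sum f S \<in> polys_over R"
  by (induction S rule: infinite_finite_induct) (auto intro: zero_polys_over add_polys_over)

lemma prod_polys_over: "(\<And>i. i \<in> S \<Longrightarrow> f i \<in> polys_over R) \<Longrightarrow> prod f S \<in> polys_over R"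
  by (induction S rule: infinite_finite_induct) (auto intro: one_polys_over mult_polys_over)

lemmas polys_over_mems = zero_polys_over one_polys_over diff_polys_over add_polys_over
  uminus_polys_over smult_polys_over mult_polys_over monom_polys_over sum_polys_over prod_polys_over

lemma synthetic_div_polys_over:
  assumes "c \<in> R" "P \<in> polys_over R"
  shows "synthetic_div P c \<in> polys_over R"
  using assms(2)
  by (induction P) (auto simp: polys_over_pCons_iff zero_polys_over intro: poly_mem assms(1))

lemma divmod_monic_polys_over:
  assumes P: "P \<in> polys_over R" "Polynomial.lead_coeff P = 1" and F: "F \<in> polys_over R"
  shows "F mod P \<in> polys_over R \<and> F div P \<in> polys_over R"
  using F
proof (induction F)
  case 0
  then show ?case by (simp add: zero_polys_over)
next
  case (pCons a F)
  then have *: "pCons a (F mod P) \<in> polys_over R"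
    by (auto simp: polys_over_pCons_iff)
  have "P \<noteq> 0" using P(2) by auto
  with * pCons show ?case
    by (auto simp: mod_pCons_eq div_pCons_eq P(2) polys_over_pCons_iff
        intro!: diff_polys_over smult_polys_over P polys_overD[OF *])
qed

end

lemma lead_prod_linear:
  fixes ds :: "'a::field list"
  shows "Polynomial.degree (\<Prod>d\<leftarrow>ds. [:- d, 1:]) = length ds"
    and "poly.coeff (\<Prod>d\<leftarrow>ds. [:- d, 1:]) (length ds) = 1"
proof -
  have "Polynomial.degree (\<Prod>d\<leftarrow>ds. [:- d, 1:]) = length ds \<and>
      Polynomial.lead_coeff (\<Prod>d\<leftarrow>ds. [:- d, 1:]) = 1"
  proof (induction ds)
    case (Cons d ds)
    then have "(\<Prod>d\<leftarrow>ds. [:- d, 1:]) \<noteq> 0" by auto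
    then have "Polynomial.degree (\<Prod>d\<leftarrow>d # ds. [:- d, 1:]) = Suc (length ds)"
      using Cons by (simp add: Polynomial.degree_mult_eq del: mult_pCons_left)
    moreover have "Polynomial.lead_coeff (\<Prod>d\<leftarrow>d # ds. [:- d, 1:]) = 1"
      using conjunct2[OF Cons] by (simp add: Polynomial.lead_coeff_mult del: mult_pCons_left)
    ultimately show ?case by simp
  qed simp
  then show "Polynomial.degree (\<Prod>d\<leftarrow>ds. [:- d, 1:]) = length ds"
    "poly.coeff (\<Prod>d\<leftarrow>ds. [:- d, 1:]) (length ds) = 1" by auto
qed

lemma coeff_prod_linear_pred:
  fixes ds :: "'a::field list"
  assumes "ds \<noteq> []"
  shows "poly.coeff (\<Prod>d\<leftarrow>ds. [:- d, 1:]) (length ds - 1) = - sum_list ds"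
proof -
  have "poly.coeff (\<Prod>d\<leftarrow>ds. [:- d, 1:]) n = - sum_list ds" if "length ds = Suc n" for n
    using that
  proof (induction ds arbitrary: n)
    case (Cons d ds)
    show ?case
    proof (cases n)
      case (Suc m)
      with Cons have "poly.coeff (\<Prod>d\<leftarrow>ds. [:- d, 1:]) m = - sum_list ds" "length ds = Suc m" by auto
      moreover have "poly.coeff (\<Prod>d\<leftarrow>ds. [:- d, 1:]) (Suc m) = 1"
        using lead_prod_linear(2)[of ds] \<open>length ds = Suc m\<close> by simp
      ultimately show ?thesis
        by (simp add: Suc coeff_pCons)
    qed (use Cons in auto)
  qed auto
  then show ?thesis using assms by (cases ds) auto
qed

section \<open>Factors of completely split polynomials modulo a prime ideal\<close>

text \<open>
  The residue classes of \<open>A\<close> form a subfield of the domain \<open>R/I\<close>. Statements about polynomials over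
  this subfield are made for representatives, with coefficients in \<open>A\<close> and congruences modulo \<open>I\<close>.
  The case \<open>I = 0\<close> covers the field extension itself, and the maximal ideal of a valuation ring covers
  the extension of residue fields.
\<close>

locale prime_residues = A: subring_set A + R: subring_set R for A R :: "'a::field set" +
  fixes I :: "'a set"
  assumes A_subset: "A \<subseteq> R" and I_subset: "I \<subseteq> R"
    and I_zero: "0 \<in> I"
    and I_diff: "x \<in> I \<Longrightarrow> y \<in> I \<Longrightarrow> x - y \<in> I"
    and I_mult: "x \<in> R \<Longrightarrow> y \<in> I \<Longrightarrow> x * y \<in> I"
    and one_notin_I: "1 \<notin> I"
    and I_prime: "x \<in> R \<Longrightarrow> y \<in> R \<Longrightarrow> x * y \<in> I \<Longrightarrow> x \<in> I \<or> y \<in> I"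
    and A_inverse: "a \<in> A \<Longrightarrow> a \<notin> I \<Longrightarrow> inverse a \<in> A"
begin

lemma I_uminus: "x \<in> I \<Longrightarrow> - x \<in> I"
  using I_diff[OF I_zero] by simp

lemma I_add: "x \<in> I \<Longrightarrow> y \<in> I \<Longrightarrow> x + y \<in> I"
  using I_diff[OF _ I_uminus] by fastforce

lemma I_sum: "(\<And>i. i \<in> S \<Longrightarrow> f i \<in> I) \<Longrightarrow> sum f S \<in> I"
  by (induction S rule: infinite_finite_induct) (auto intro: I_zero I_add)

lemma I_poly_diff: "P \<in> polys_over I \<Longrightarrow> Q \<in> polys_over I \<Longrightarrow> P - Q \<in> polys_over I"
  by (simp add: polys_over_def I_diff)

lemma I_poly_add: "P \<in> polys_over I \<Longrightarrow> Q \<in> polys_over I \<Longrightarrow> P + Q \<in> polys_over I"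
  by (simp add: polys_over_def I_add)

lemma I_poly_mult: "P \<in> polys_over R \<Longrightarrow> Q \<in> polys_over I \<Longrightarrow> P * Q \<in> polys_over I"
  by (simp add: polys_over_def Polynomial.coeff_mult I_sum I_mult)

lemma I_poly_const: "a \<in> I \<Longrightarrow> [:a:] \<in> polys_over I"
  by (auto simp: polys_over_def coeff_pCons I_zero split: nat.split)

lemma I_poly_eval: "P \<in> polys_over I \<Longrightarrow> x \<in> R \<Longrightarrow> poly P x \<in> I"
  unfolding poly_altdef
  by (intro I_sum) (metis I_mult R.power_mem mult.commute polys_overD)

lemma I_poly_cancel_linear:
  assumes "[:- c, 1:] * G \<in> polys_over I" "c \<in> R"
  shows "G \<in> polys_over I"
proof (rule polys_overI)
  have step: "poly.coeff G i \<in> I" if "poly.coeff G (Suc i) \<in> I" for i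
  proof -
    have "poly.coeff G i - c * poly.coeff G (Suc i) \<in> I"
      using polys_overD[OF assms(1), of "Suc i"] by (simp add: algebra_simps)
    from I_add[OF this I_mult[OF assms(2) that]] show ?thesis by simp
  qed
  fix i
  show "poly.coeff G i \<in> I"
  proof (cases "i \<le> Suc (Polynomial.degree G)")
    case True
    then show ?thesis
    proof (induction rule: inc_induct)
      case base
      then show ?case by (simp add: Polynomial.coeff_eq_0 I_zero)
    qed (rule step)
  qed (simp add: Polynomial.coeff_eq_0 I_zero)
qed

text \<open>
  The roots \<open>c\<close> are split off one at a time: since \<open>I\<close> is prime, \<open>c\<close> is a root modulo \<open>I\<close> of \<open>P\<close> or of
  \<open>Q\<close>, and the linear factor can be cancelled from the congruence.
\<close>

lemma factor_of_split:
  assumes "set cs \<subseteq> R" "P \<in> polys_over R" "Q \<in> polys_over R"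
    and "Polynomial.lead_coeff P = 1" "Polynomial.lead_coeff Q = 1"
    and "P * Q - (\<Prod>c\<leftarrow>cs. [:- c, 1:]) \<in> polys_over I"
  shows "\<exists>ds. set ds \<subseteq> set cs \<and> length ds = Polynomial.degree P \<and>
           P - (\<Prod>d\<leftarrow>ds. [:- d, 1:]) \<in> polys_over I"
  using assms
proof (induction cs arbitrary: P Q)
  case Nil
  have nz: "P \<noteq> 0" "Q \<noteq> 0" using Nil by auto
  have lead: "Polynomial.lead_coeff (P * Q) = 1"
    using Nil by (simp add: Polynomial.lead_coeff_mult)
  have "Polynomial.degree (P * Q) = 0"
  proof (rule ccontr)
    assume "Polynomial.degree (P * Q) \<noteq> 0"
    with polys_overD[OF Nil(6), of "Polynomial.degree (P * Q)"] lead
    have "1 \<in> I" by simp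
    with one_notin_I show False ..
  qed
  then have d0: "Polynomial.degree P = 0"
    using nz by (simp add: Polynomial.degree_mult_eq)
  then have "P = 1"
    using Nil(4) by (metis coeff_pCons_0 degree_eq_zeroE one_pCons)
  then show ?case
    by (intro exI[of _ "[]"]) (auto simp: polys_over_def I_zero)
next
  case (Cons c cs)
  let ?F = "\<Prod>c\<leftarrow>cs. [:- c, 1:]"
  have c: "c \<in> R" using Cons by auto
  have split: "\<exists>P1. P1 \<in> polys_over R \<and> Polynomial.lead_coeff P1 = 1 \<and>
      Polynomial.degree P = Suc (Polynomial.degree P1) \<and>
      P - [:- c, 1:] * P1 \<in> polys_over I" if P: "P \<in> polys_over R" "Polynomial.lead_coeff P = 1" "poly P c \<in> I" for P
  proof -
    define P1 where "P1 = synthetic_div P c"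
    have eq: "[:-c, 1:] * P1 + [:poly P c:] = P"
      unfolding P1_def by (rule synthetic_div_correct')
    have "Polynomial.degree P \<noteq> 0"
    proof
      assume "Polynomial.degree P = 0"
      then have "P = 1" using P(2) by (metis coeff_pCons_0 degree_eq_zeroE one_pCons)
      with P(3) one_notin_I show False by simp
    qed
    then have "P1 \<noteq> 0" unfolding P1_def by (simp add: synthetic_div_eq_0_iff)
    then have deg: "Polynomial.degree ([:-c, 1:] * P1) = Suc (Polynomial.degree P1)"
      by (subst Polynomial.degree_mult_eq) auto
    then have degP: "Polynomial.degree P = Suc (Polynomial.degree P1)"
      by (subst eq[symmetric], subst Polynomial.degree_add_eq_left) auto
    have "Polynomial.lead_coeff P = poly.coeff ([:-c, 1:] * P1) (Suc (Polynomial.degree P1))"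
      unfolding degP by (subst eq[symmetric]) simp
    also have "\<dots> = Polynomial.lead_coeff P1"
      by (simp add: Polynomial.coeff_eq_0)
    finally have "Polynomial.lead_coeff P1 = 1" using P by simp
    moreover have "P - [:- c, 1:] * P1 \<in> polys_over I"
      using I_poly_const[OF P(3)] eq by (metis add_diff_cancel_left')
    ultimately show ?thesis
      using degP R.synthetic_div_polys_over[OF c P(1)] unfolding P1_def by blast
  qed
  have "poly (P * Q - (\<Prod>c\<leftarrow>c # cs. [:- c, 1:])) c \<in> I"
    using I_poly_eval[OF Cons.prems(6) c] .
  then have "poly P c * poly Q c \<in> I" by simp
  then consider "poly P c \<in> I" | "poly Q c \<in> I"
    using I_prime R.poly_mem c Cons.prems by blast
  then show ?case
  proof cases
    case 1
    then obtain P1 where P1: "P1 \<in> polys_over R" "Polynomial.lead_coeff P1 = 1"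
      "Polynomial.degree P = Suc (Polynomial.degree P1)" "P - [:- c, 1:] * P1 \<in> polys_over I"
      using split Cons.prems by blast
    have "P * Q - [:- c, 1:] * ?F \<in> polys_over I"
      using Cons.prems(6) by (simp del: mult_pCons_left)
    from I_poly_diff[OF this I_poly_mult[OF Cons.prems(3) P1(4)]]
    have "[:- c, 1:] * (P1 * Q - ?F) \<in> polys_over I"
      by (simp add: algebra_simps del: mult_pCons_left)
    then have "P1 * Q - ?F \<in> polys_over I" using I_poly_cancel_linear c by blast
    with Cons.IH[of P1 Q] Cons.prems P1 obtain ds where ds: "set ds \<subseteq> set cs"
      "length ds = Polynomial.degree P1" "P1 - (\<Prod>d\<leftarrow>ds. [:- d, 1:]) \<in> polys_over I" by auto
    have "[:- c, 1:] \<in> polys_over R"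
      using c by (simp add: R.polys_over_pCons_iff R.subring_mems R.polys_over_mems)
    from I_poly_add[OF P1(4) I_poly_mult[OF this ds(3)]]
    have "P - (\<Prod>d\<leftarrow>c # ds. [:- d, 1:]) \<in> polys_over I"
      by (simp add: algebra_simps del: mult_pCons_left)
    then show ?thesis using ds P1 by (intro exI[of _ "c # ds"]) auto
  next
    case 2
    then obtain Q1 where Q1: "Q1 \<in> polys_over R" "Polynomial.lead_coeff Q1 = 1"
      "Q - [:- c, 1:] * Q1 \<in> polys_over I"
      using split Cons.prems by blast
    have "P * Q - [:- c, 1:] * ?F \<in> polys_over I"
      using Cons.prems(6) by (simp del: mult_pCons_left)
    from I_poly_diff[OF this I_poly_mult[OF Cons.prems(2) Q1(3)]]
    have "[:- c, 1:] * (P * Q1 - ?F) \<in> polys_over I"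
      by (simp add: algebra_simps del: mult_pCons_left)
    then have "P * Q1 - ?F \<in> polys_over I" using I_poly_cancel_linear c by blast
    with Cons.IH[of P Q1] Cons.prems Q1 show ?thesis by auto
  qed
qed

end

section \<open>Prime characteristic\<close>

lemma of_nat_power_CHAR:
  assumes "Factorial_Ring.prime CHAR('a::field)"
  shows "(of_nat i :: 'a) ^ CHAR('a) = of_nat i"
proof (induction i)
  case 0
  then show ?case using assms by (simp add: prime_gt_0_nat)
next
  case (Suc i)
  then show ?case by (simp add: freshmans_dream[OF assms refl])
qed

lemma of_nat_inverse_CHAR:
  assumes "Factorial_Ring.prime CHAR('a::field)" "0 < n" "n < CHAR('a)"
  shows "\<exists>m. of_nat m * (of_nat n :: 'a) = 1"
proof -
  have "coprime n CHAR('a)"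
    using assms by (metis coprime_commute nat_dvd_not_less prime_imp_coprime_nat)
  then obtain m where "[n * m = 1] (mod CHAR('a))"
    using cong_solve_coprime_nat by auto
  then have "(of_nat (n * m) :: 'a) = of_nat 1"
    by (metis of_nat_eq_iff_cong_CHAR)
  then show ?thesis by (intro exI[of _ m]) (simp add: mult.commute)
qed

lemma degree_diff_eq_left:
  "Polynomial.degree Q < Polynomial.degree P \<Longrightarrow> Polynomial.degree (P - Q :: 'a::field poly) = Polynomial.degree P"
  using Polynomial.degree_add_eq_left[of "- Q" P] by simp

text \<open>
  The roots of the additive polynomial \<open>X\<^sup>p - t\<^bsup>p-1\<^esup>X\<close> are the multiples of \<open>t\<close> by elements of the prime
  field, so the elements at which it takes the same value as at \<open>u\<close> are their translates by \<open>u\<close>. For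
  \<open>t = 1\<close> this is the Artin--Schreier polynomial; modulo an ideal that contains \<open>t\<close> it becomes purely
  inseparable. Both kinds of residue field extension are treated through this one formula.
\<close>

lemma additive_poly_split:
  fixes u t :: "'a::field"
  assumes p: "Factorial_Ring.prime CHAR('a)" "p = CHAR('a)" and t: "t \<noteq> 0"
  shows "Polynomial.monom 1 p - [:u ^ p - t ^ (p - 1) * u, t ^ (p - 1):] =
    (\<Prod>c\<leftarrow>map (\<lambda>i. u + of_nat i * t) [0..<p]. [:- c, 1:])" (is "?F = ?G")
proof -
  have p1: "1 < p" using p prime_gt_1_nat by blast
  let ?cs = "map (\<lambda>i. u + of_nat i * t) [0..<p]"
  have degl: "Polynomial.degree [:u ^ p - t ^ (p - 1) * u, t ^ (p - 1):] < p"
    using p1 by (auto simp: degree_pCons_eq_if)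
  have dF: "Polynomial.degree ?F = p"
    using degree_diff_eq_left[of "[:u ^ p - t ^ (p - 1) * u, t ^ (p - 1):]" "Polynomial.monom 1 p"] degl by (simp add: Polynomial.degree_monom_eq)
  have lF: "poly.coeff ?F p = 1"
    using degl by (simp add: Polynomial.coeff_eq_0)
  have dG: "Polynomial.degree ?G = p" and lG: "poly.coeff ?G p = 1"
    using lead_prod_linear[of ?cs] by auto
  have inj: "inj_on (\<lambda>i. u + of_nat i * t) {..<p}"
  proof
    fix i j assume "i \<in> {..<p}" "j \<in> {..<p}" "u + of_nat i * t = u + of_nat j * t"
    then show "i = j"
      using t p by (auto simp: of_nat_eq_iff_cong_CHAR cong_def)
  qed
  show ?thesis
  proof (rule poly_eqI_degree_lead_coeff[where n = p and A = "(\<lambda>i. u + of_nat i * t) ` {..<p}"])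
    show "p \<le> card ((\<lambda>i. u + of_nat i * t) ` {..<p})"
      by (simp add: card_image[OF inj])
    fix x assume "x \<in> (\<lambda>i. u + of_nat i * t) ` {..<p}"
    then obtain i where i: "i < p" "x = u + of_nat i * t" by auto
    have "x ^ p = u ^ p + (of_nat i * t) ^ p"
      unfolding i(2) by (rule freshmans_dream[OF p])
    moreover have "(of_nat i * t) ^ p = of_nat i * t ^ p"
      unfolding power_mult_distrib p(2) of_nat_power_CHAR[OF p(1)] ..
    moreover have "t ^ p = t ^ (p - 1) * t"
      using p1 power_minus_mult[of p t] by simp
    moreover have "poly ?F x = x ^ p - u ^ p - t ^ (p - 1) * (x - u)"
      by (simp add: poly_monom algebra_simps)
    ultimately have "poly ?F x = 0" by (simp add: i(2))
    moreover have "poly ?G x = 0"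
      using i by (auto simp: poly_prod_list o_def prod_list_zero_iff image_iff intro!: bexI[of _ i])
    ultimately show "poly ?F x = poly ?G x" by simp
  qed (use dF dG lF lG in auto)
qed

context prime_residues
begin

text \<open>
  Modulo \<open>I\<close>, a minimal relation \<open>P\<close> of degree \<open>d\<close> divides \<open>\<Prod>(X - u - it)\<close>. It is therefore itself
  a product of \<open>d\<close> such factors, and its coefficient at \<open>d - 1\<close> is \<open>- (d u + m t)\<close> for some \<open>m\<close>. As
  \<open>0 < d < p\<close> is invertible, \<open>u\<close> is congruent to an element of \<open>A\<close>.
\<close>

lemma powers_independent:
  assumes p: "Factorial_Ring.prime CHAR('a)" "p = CHAR('a)"
    and u: "u \<in> R" "\<And>c. c \<in> A \<Longrightarrow> u - c \<notin> I"
    and t: "t \<in> A" "t \<noteq> 0" and b: "b \<in> A" and eq: "u ^ p - t ^ (p - 1) * u - b \<in> I"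
    and P: "P \<in> polys_over A" "Polynomial.degree P < p" "poly P u \<in> I"
  shows "P \<in> polys_over I"
proof (rule ccontr)
  have p1: "1 < p" using p prime_gt_1_nat by blast
  note AR = A_subset[THEN subsetD] polys_over_mono[OF A_subset, THEN subsetD]
  let ?bad = "\<lambda>n. \<exists>P. P \<in> polys_over A \<and> Polynomial.degree P = n \<and> poly P u \<in> I \<and> P \<notin> polys_over I"
  assume "P \<notin> polys_over I"
  then have ex: "?bad (Polynomial.degree P)" using P by blast
  define d where "d = (LEAST n. ?bad n)"
  have dp: "d < p" using Least_le[of ?bad, OF ex] P unfolding d_def by simp
  have minimal: "Q \<in> polys_over I"
    if "Q \<in> polys_over A" "Polynomial.degree Q < d" "poly Q u \<in> I" for Q
    using not_less_Least[of "Polynomial.degree Q" ?bad] that unfolding d_def by blast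
  obtain P0 where P0: "P0 \<in> polys_over A" "Polynomial.degree P0 = d" "poly P0 u \<in> I"
    "P0 \<notin> polys_over I"
    using LeastI[of ?bad, OF ex] unfolding d_def by blast
  \<comment> \<open>a leading coefficient in \<open>I\<close> could be dropped, against minimality of the degree\<close>
  have lead: "Polynomial.lead_coeff P0 \<notin> I"
  proof
    let ?m = "Polynomial.monom (Polynomial.lead_coeff P0) d"
    assume I: "Polynomial.lead_coeff P0 \<in> I"
    then have m: "?m \<in> polys_over I" by (auto simp: polys_over_def I_zero)
    have "P0 - ?m \<in> polys_over I"
    proof (cases "d = 0")
      case True
      then have "P0 = ?m" using P0(2) by (metis degree_eq_zeroE coeff_pCons_0 monom_0)
      then show ?thesis by (simp add: polys_over_def I_zero)
    next
      case False
      have "Polynomial.degree (P0 - ?m) < d"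
      proof -
        have "Polynomial.degree (P0 - ?m) \<le> d - 1"
        proof (rule Polynomial.degree_le, intro allI impI)
          fix i assume "d - 1 < i"
          then consider "i = d" | "d < i" by linarith
          then show "poly.coeff (P0 - ?m) i = 0"
            by cases (auto simp: P0(2) Polynomial.coeff_eq_0)
        qed
        then show ?thesis using False by simp
      qed
      moreover have "P0 - ?m \<in> polys_over A"
        using P0 by (intro A.polys_over_mems) (auto dest: polys_overD)
      moreover have "poly (P0 - ?m) u \<in> I"
        using I_poly_eval[OF m u(1)] P0 by (simp add: I_diff)
      ultimately show ?thesis by (metis minimal)
    qed
    from I_poly_add[OF this m] P0 show False by simp
  qed
  define a where "a = inverse (Polynomial.lead_coeff P0)"
  have aA: "a \<in> A" unfolding a_def using lead P0 by (intro A_inverse polys_overD)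
  have a0: "Polynomial.lead_coeff P0 \<noteq> 0" using lead I_zero by auto
  define P1 where "P1 = Polynomial.smult a P0"
  have P1: "P1 \<in> polys_over A" "Polynomial.degree P1 = d" "Polynomial.lead_coeff P1 = 1" "poly P1 u \<in> I"
    using P0 aA a0 AR I_mult unfolding P1_def a_def by (auto intro: A.polys_over_mems)
  have d0: "d \<noteq> 0"
  proof
    assume "d = 0"
    then have "P1 = 1" using P1 by (metis coeff_pCons_0 degree_eq_zeroE one_pCons)
    with P1 one_notin_I show False by simp
  qed
  define F where "F = Polynomial.monom 1 p - [:b, t ^ (p - 1):]"
  have degl: "Polynomial.degree [:b, t ^ (p - 1):] < p"
    using p1 by (auto simp: degree_pCons_eq_if)
  have F: "F \<in> polys_over A"
    unfolding F_def using t b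
    by (auto intro!: A.polys_over_mems A.subring_mems simp: A.polys_over_pCons_iff)
  have degF: "Polynomial.degree F = p"
    unfolding F_def using degree_diff_eq_left[of "[:b, t ^ (p - 1):]" "Polynomial.monom 1 p"] degl by (simp add: Polynomial.degree_monom_eq)
  have leadF: "Polynomial.lead_coeff F = 1"
    unfolding degF using degl by (simp add: F_def Polynomial.coeff_eq_0)
  have Fu: "poly F u \<in> I" using eq by (simp add: F_def poly_monom algebra_simps)
  define r where "r = F mod P1"
  define q where "q = F div P1"
  have Feq: "F = P1 * q + r" unfolding q_def r_def by simp
  have qr: "q \<in> polys_over A" "r \<in> polys_over A"
    using A.divmod_monic_polys_over[OF P1(1,3) F] unfolding q_def r_def by auto
  have P1nz: "P1 \<noteq> 0" using P1 by auto
  have degr: "Polynomial.degree r < d"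
    using Polynomial.degree_mod_less[OF P1nz, of F] d0 P1(2) unfolding r_def by auto
  have "poly r u = poly F u - poly q u * poly P1 u" using Feq by simp
  then have "poly r u \<in> I"
    using Fu P1(4) I_diff I_mult R.poly_mem[OF AR(2)[OF qr(1)] u(1)] by metis
  then have rI: "r \<in> polys_over I" using minimal qr degr by blast
  have leadq: "Polynomial.lead_coeff q = 1"
  proof -
    have "P1 * q \<noteq> 0" using Feq degF degr dp by auto
    have "Polynomial.degree (P1 * q) = p"
    proof (rule ccontr)
      assume ne: "Polynomial.degree (P1 * q) \<noteq> p"
      show False
      proof (cases "Polynomial.degree r < Polynomial.degree (P1 * q)")
        case True
        then show False using ne degF Feq Polynomial.degree_add_eq_left by metis
      next
        case False
        then have "Polynomial.degree F \<le> Polynomial.degree r" using Feq Polynomial.degree_add_le by (metis le_refl not_less)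
        then show False using degF degr dp by simp
      qed
    qed
    then have "Polynomial.lead_coeff (P1 * q) = poly.coeff F p"
      unfolding Feq using degr dp by (simp add: Polynomial.coeff_eq_0)
    then show ?thesis using leadF degF P1 by (simp add: Polynomial.lead_coeff_mult)
  qed
  let ?cs = "map (\<lambda>i. u + of_nat i * t) [0..<p]"
  have "P1 * q - (\<Prod>c\<leftarrow>?cs. [:- c, 1:]) = [:u ^ p - t ^ (p - 1) * u - b:] - r"
    unfolding additive_poly_split[OF p t(2), symmetric] using Feq unfolding F_def by (simp add: algebra_simps)
  also have "\<dots> \<in> polys_over I"
    using eq rI by (intro I_poly_diff I_poly_const)
  finally obtain ds where ds: "set ds \<subseteq> set ?cs" "length ds = d"
    "P1 - (\<Prod>d\<leftarrow>ds. [:- d, 1:]) \<in> polys_over I"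
    using factor_of_split[of ?cs P1 q] qr P1 leadq AR u t
    by (auto intro!: R.subring_mems)
  have "\<exists>m. sum_list ds = of_nat (length ds) * u + of_nat m * t"
    using ds(1)
  proof (induction ds)
    case (Cons x ds)
    then obtain m i where "sum_list ds = of_nat (length ds) * u + of_nat m * t" "x = u + of_nat i * t"
      by auto
    then show ?case by (intro exI[of _ "m + i"]) (simp add: algebra_simps)
  qed (auto intro: exI[of _ 0])
  then obtain m where m: "sum_list ds = of_nat d * u + of_nat m * t" using ds(2) by auto
  have c1: "poly.coeff P1 (d - 1) + (of_nat d * u + of_nat m * t) \<in> I"
  proof -
    have "poly.coeff (\<Prod>d\<leftarrow>ds. [:- d, 1:]) (d - 1) = - sum_list ds"
      using coeff_prod_linear_pred[of ds] ds(2) d0 by auto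
    then show ?thesis
      using polys_overD[OF ds(3), of "d - 1"] m by (simp only: Polynomial.coeff_diff diff_minus_eq_add)
  qed
  obtain e where e: "of_nat e * (of_nat d :: 'a) = 1"
    using of_nat_inverse_CHAR[OF p(1), of d] d0 dp p by auto
  let ?c = "- of_nat e * (poly.coeff P1 (d - 1) + of_nat m * t)"
  have "of_nat e * (poly.coeff P1 (d - 1) + (of_nat d * u + of_nat m * t)) \<in> I"
    using c1 by (intro I_mult R.subring_mems)
  also have "of_nat e * (poly.coeff P1 (d - 1) + (of_nat d * u + of_nat m * t))
      = (of_nat e * of_nat d) * u - ?c" by (simp add: algebra_simps)
  finally have "u - ?c \<in> I" unfolding e by simp
  moreover have "?c \<in> A"
    using t P1 by (intro A.subring_mems) (auto dest: polys_overD)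
  ultimately show False using u by blast
qed

end

section \<open>Valuations\<close>

definition nsmul :: "nat \<Rightarrow> 'g::linordered_ab_group_add \<Rightarrow> 'g" where
  "nsmul n g = ((+) g ^^ n) 0"

lemma nsmul_0 [simp]: "nsmul 0 g = 0"
  and nsmul_Suc [simp]: "nsmul (Suc n) g = g + nsmul n g"
  by (simp_all add: nsmul_def)

lemma nsmul_add: "nsmul (m + n) g = nsmul m g + nsmul n g"
  by (induction m) (auto simp: add_ac)

lemma nsmul_mono: "g \<le> h \<Longrightarrow> nsmul n g \<le> nsmul n h"
  by (induction n) (auto intro: add_mono)

lemma nsmul_strict_mono: "g < h \<Longrightarrow> 0 < n \<Longrightarrow> nsmul n g < nsmul n h"
  by (cases n) (auto intro!: add_less_le_mono nsmul_mono)

lemma nsmul_zero_right [simp]: "nsmul n 0 = 0"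
  by (induction n) auto

lemma nsmul_uminus: "nsmul n (- g) = - nsmul n g"
  by (induction n) auto

lemma nsmul_mult: "nsmul (m * n) g = nsmul m (nsmul n g)"
  by (induction m) (auto simp: nsmul_add)

locale valued_field =
  fixes v :: "'a::field \<Rightarrow> 'g::linordered_ab_group_add"
  assumes valuation: "valuation_on UNIV v"
begin

lemma v_mult: "x \<noteq> 0 \<Longrightarrow> y \<noteq> 0 \<Longrightarrow> v (x * y) = v x + v y"
  using valuation by (simp add: valuation_on_def)

lemma v_add_ge: "x \<noteq> 0 \<Longrightarrow> y \<noteq> 0 \<Longrightarrow> x + y \<noteq> 0 \<Longrightarrow> min (v x) (v y) \<le> v (x + y)"
  using valuation by (simp add: valuation_on_def)

lemma v_one [simp]: "v 1 = 0"
  using v_mult[of 1 1] by simp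

lemma v_power: "x \<noteq> 0 \<Longrightarrow> v (x ^ n) = nsmul n (v x)"
  by (induction n) (auto simp: v_mult)

lemma v_inverse: "x \<noteq> 0 \<Longrightarrow> v (inverse x) = - v x"
  using v_mult[of x "inverse x"] by (simp add: eq_neg_iff_add_eq_0 add.commute)

lemma v_divide: "x \<noteq> 0 \<Longrightarrow> y \<noteq> 0 \<Longrightarrow> v (x / y) = v x - v y"
  by (simp add: divide_inverse v_mult v_inverse)

lemma v_uminus [simp]: "v (- x) = v x"
proof (cases "x = 0")
  case False
  have "v (- 1) + v (- 1) = 0" using v_mult[of "- 1" "- 1"] by simp
  then have "v (- 1) = 0"
    using double_zero by blast
  then show ?thesis using v_mult[of "- 1" x] False by simp
qed simp

text \<open>
  Zero is put into each of these sets, so that they are groups whatever the value \<open>v 0\<close> is.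
\<close>

definition vge :: "'g \<Rightarrow> 'a set" where "vge g = {x. x = 0 \<or> g \<le> v x}"
definition vgt :: "'g \<Rightarrow> 'a set" where "vgt g = {x. x = 0 \<or> g < v x}"

lemma vge_iff: "x \<noteq> 0 \<Longrightarrow> x \<in> vge g \<longleftrightarrow> g \<le> v x"
  and vgt_iff: "x \<noteq> 0 \<Longrightarrow> x \<in> vgt g \<longleftrightarrow> g < v x"
  by (auto simp: vge_def vgt_def)

lemma zero_vge [simp]: "0 \<in> vge g" and zero_vgt [simp]: "0 \<in> vgt g"
  by (auto simp: vge_def vgt_def)

lemma vgt_subset_vge: "vgt g \<subseteq> vge g"
  by (auto simp: vge_def vgt_def)

lemma vge_mono: "h \<le> g \<Longrightarrow> vge g \<subseteq> vge h"
  and vge_subset_vgt: "h < g \<Longrightarrow> vge g \<subseteq> vgt h"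
  by (auto simp: vge_def vgt_def)

lemma vge_uminus: "x \<in> vge g \<Longrightarrow> - x \<in> vge g"
  and vgt_uminus: "x \<in> vgt g \<Longrightarrow> - x \<in> vgt g"
  by (auto simp: vge_def vgt_def)

lemma vge_add: "x \<in> vge g \<Longrightarrow> y \<in> vge g \<Longrightarrow> x + y \<in> vge g"
  using order.trans[OF _ v_add_ge[of x y], of g] by (cases "x = 0 \<or> y = 0 \<or> x + y = 0") (auto simp: vge_def)

lemma vgt_add: "x \<in> vgt g \<Longrightarrow> y \<in> vgt g \<Longrightarrow> x + y \<in> vgt g"
  using less_le_trans[OF _ v_add_ge[of x y], of g] by (cases "x = 0 \<or> y = 0 \<or> x + y = 0") (auto simp: vgt_def)

lemma vge_diff: "x \<in> vge g \<Longrightarrow> y \<in> vge g \<Longrightarrow> x - y \<in> vge g"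
  using vge_add[OF _ vge_uminus] by fastforce

lemma vgt_diff: "x \<in> vgt g \<Longrightarrow> y \<in> vgt g \<Longrightarrow> x - y \<in> vgt g"
  using vgt_add[OF _ vgt_uminus] by fastforce

lemma vge_sum: "(\<And>i. i \<in> S \<Longrightarrow> f i \<in> vge g) \<Longrightarrow> sum f S \<in> vge g"
  by (induction S rule: infinite_finite_induct) (auto intro: vge_add)

lemma vgt_sum: "(\<And>i. i \<in> S \<Longrightarrow> f i \<in> vgt g) \<Longrightarrow> sum f S \<in> vgt g"
  by (induction S rule: infinite_finite_induct) (auto intro: vgt_add)

lemma vge_mult: "x \<in> vge g \<Longrightarrow> y \<in> vge h \<Longrightarrow> x * y \<in> vge (g + h)"
  by (cases "x = 0 \<or> y = 0") (auto simp: vge_def v_mult intro: add_mono)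

lemma vgt_mult: "x \<in> vge g \<Longrightarrow> y \<in> vgt h \<Longrightarrow> x * y \<in> vgt (g + h)"
  by (cases "x = 0 \<or> y = 0") (auto simp: vge_def vgt_def v_mult intro: add_le_less_mono)

lemma vge_self: "x \<in> vge (v x)"
  by (simp add: vge_def)

lemma not_vgt_self: "x \<noteq> 0 \<Longrightarrow> x \<notin> vgt (v x)"
  by (simp add: vgt_def)

lemma v_add_eq:
  assumes "x \<noteq> 0" "y \<in> vgt (v x)"
  shows "x + y \<noteq> 0" "v (x + y) = v x"
proof -
  show nz: "x + y \<noteq> 0"
    using assms by (metis add.commute add_eq_0_iff not_vgt_self vgt_uminus)
  have "x + y \<notin> vgt (v x)"
    using vgt_diff[of "x + y" "v x" y] assms not_vgt_self by auto
  moreover have "x + y \<in> vge (v x)"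
    using assms vgt_subset_vge by (intro vge_add vge_self) auto
  ultimately show "v (x + y) = v x" using nz by (simp add: vge_iff vgt_iff)
qed

lemma v_diff_eq:
  assumes "x \<noteq> 0" "y \<in> vgt (v x)"
  shows "x - y \<noteq> 0" "v (x - y) = v x"
  using v_add_eq[OF assms(1) vgt_uminus[OF assms(2)]] by auto

lemma v_cong:
  assumes "x \<noteq> 0" "y - x \<in> vgt (v x)"
  shows "y \<noteq> 0" "v y = v x"
  using v_add_eq[OF assms] by auto

lemma subring_vge: "subring_set (vge 0)"
  using vge_mult[of _ 0 _ 0] by unfold_locales (auto simp: vge_iff intro: vge_diff)

lemma of_nat_unit:
  assumes "Factorial_Ring.prime CHAR('a)" "0 < n" "n < CHAR('a)"
  shows "v (of_nat n) = 0" "of_nat n \<noteq> (0::'a)"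
proof -
  obtain m where m: "of_nat m * (of_nat n :: 'a) = 1"
    using of_nat_inverse_CHAR[OF assms] by blast
  then show nz: "of_nat n \<noteq> (0::'a)" by auto
  have "(of_nat m :: 'a) \<noteq> 0" using m by auto
  then have "v (of_nat m) + v (of_nat n) = 0" "0 \<le> v (of_nat m)" "0 \<le> v (of_nat n)"
    using v_mult[of "of_nat m" "of_nat n"] nz m subring_set.of_nat_mem[OF subring_vge]
    by (auto simp: vge_iff[symmetric])
  then show "v (of_nat n) = 0" by (metis add_nonneg_eq_0_iff)
qed

lemma valuation_ring_eq: "valuation_ring F v = F \<inter> vge 0"
  and valuation_ideal_eq: "valuation_ideal F v = F \<inter> vgt 0"
  by (auto simp: valuation_ring_def valuation_ideal_def vge_def vgt_def)

end

locale subfield_set = subring_set +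
  assumes inverse_mem: "x \<in> R \<Longrightarrow> inverse x \<in> R"
begin

lemma divide_mem: "x \<in> R \<Longrightarrow> y \<in> R \<Longrightarrow> x / y \<in> R"
  by (simp add: divide_inverse mult_mem inverse_mem)

lemmas subfield_mems = subring_mems inverse_mem divide_mem

end

locale valued_extension = valued_field v + K: subfield_set K
  for v :: "'a::field \<Rightarrow> 'g::linordered_ab_group_add" and K :: "'a set"
begin

abbreviation A where "A \<equiv> K \<inter> vge 0"

lemma A_subring: "subring_set A"
proof -
  interpret O: subring_set "vge 0" by (rule subring_vge)
  show ?thesis by unfold_locales (auto intro: O.subring_mems K.subring_mems)
qed

lemma prime_residues_valuation: "prime_residues A (vge 0) (vgt 0)"
proof -
  interpret A: subring_set A by (rule A_subring)
  interpret O: subring_set "vge 0" by (rule subring_vge)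
  show ?thesis
  proof unfold_locales
    fix x y assume "x \<in> vge 0" "y \<in> vgt 0"
    then show "x * y \<in> vgt 0" using vgt_mult[of x 0 y 0] by simp
  next
    fix x y assume "x \<in> vge 0" "y \<in> vge 0" and xy: "x * y \<in> vgt 0"
    show "x \<in> vgt 0 \<or> y \<in> vgt 0"
    proof (rule ccontr)
      assume *: "\<not> ?thesis"
      then have "x \<noteq> 0" "y \<noteq> 0" by auto
      then have "v x \<le> 0" "v y \<le> 0" "0 < v x + v y"
        using * xy by (auto simp: vgt_iff v_mult)
      then show False by (metis add_nonpos_nonpos not_le)
    qed
  next
    fix a assume "a \<in> A" "a \<notin> vgt 0"
    then show "inverse a \<in> A"
      by (cases "a = 0") (auto simp: vge_iff vgt_iff v_inverse K.inverse_mem)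
  qed (auto simp: vgt_iff vgt_subset_vge[THEN subsetD] intro: vgt_diff)
qed

lemma prime_residues_field: "prime_residues K UNIV {0}"
  by unfold_locales (auto intro: K.subfield_mems)

end

section \<open>Polynomials near an element without best approximation\<close>

text \<open>
  The Hasse derivative, or divided derivative: the coefficient of \<open>x\<^sup>k\<close> in \<open>P(c + x)\<close> as a polynomial in
  \<open>c\<close>.
\<close>

definition hasse :: "nat \<Rightarrow> 'a::field poly \<Rightarrow> 'a poly" where
  "hasse k P = (\<Sum>i\<le>Polynomial.degree P.
     Polynomial.monom (of_nat (i choose k) * poly.coeff P i) (i - k))"

lemma poly_hasse:
  "poly (hasse k P) c = (\<Sum>i\<le>Polynomial.degree P. of_nat (i choose k) * poly.coeff P i * c ^ (i - k))"
  by (simp add: hasse_def poly_sum poly_monom)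

lemma taylor_expansion:
  "poly P (c + x) = (\<Sum>k\<le>Polynomial.degree P. poly (hasse k P) c * x ^ k)"
proof -
  let ?d = "Polynomial.degree P"
  have "poly P (c + x) = (\<Sum>i\<le>?d. poly.coeff P i * (x + c) ^ i)"
    by (simp add: poly_altdef add.commute)
  also have "\<dots> = (\<Sum>i\<le>?d. \<Sum>k\<le>?d. of_nat (i choose k) * poly.coeff P i * c ^ (i - k) * x ^ k)"
  proof (rule sum.cong[OF refl])
    fix i assume i: "i \<in> {..?d}"
    have "poly.coeff P i * (x + c) ^ i
        = (\<Sum>k\<le>i. of_nat (i choose k) * poly.coeff P i * c ^ (i - k) * x ^ k)"
      unfolding binomial_ring sum_distrib_left by (simp add: mult_ac)
    also have "\<dots> = (\<Sum>k\<le>?d. of_nat (i choose k) * poly.coeff P i * c ^ (i - k) * x ^ k)"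
      using i by (intro sum.mono_neutral_left) (auto simp: binomial_eq_0)
    finally show "poly.coeff P i * (x + c) ^ i
        = (\<Sum>k\<le>?d. of_nat (i choose k) * poly.coeff P i * c ^ (i - k) * x ^ k)" .
  qed
  also have "\<dots> = (\<Sum>k\<le>?d. poly (hasse k P) c * x ^ k)"
    by (subst sum.swap) (simp add: poly_hasse sum_distrib_right)
  finally show ?thesis .
qed

lemma hasse_0: "poly (hasse 0 P) c = poly P c"
  by (simp add: poly_hasse) (simp add: poly_altdef)

lemma taylor_expansion':
  "poly P (c + x) = poly P c + (\<Sum>k\<in>{1..Polynomial.degree P}. poly (hasse k P) c * x ^ k)"
proof -
  have "{..Polynomial.degree P} = insert 0 {1..Polynomial.degree P}" by auto
  then show ?thesis by (simp add: taylor_expansion hasse_0)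
qed

lemma degree_hasse: "Polynomial.degree (hasse k P) \<le> Polynomial.degree P - k"
  unfolding hasse_def
proof (rule Polynomial.degree_sum_le)
  fix i assume "i \<in> {..Polynomial.degree P}"
  then show "Polynomial.degree (Polynomial.monom (of_nat (i choose k) * poly.coeff P i) (i - k))
      \<le> Polynomial.degree P - k"
    by (intro order.trans[OF Polynomial.degree_monom_le]) auto
qed simp

lemma hasse_eq_0: "Polynomial.degree P < k \<Longrightarrow> hasse k P = 0"
  by (auto simp: hasse_def binomial_eq_0 intro!: sum.neutral)

lemma hasse_degree_nonzero: "P \<noteq> 0 \<Longrightarrow> hasse (Polynomial.degree P) P \<noteq> 0"
proof -
  assume P: "P \<noteq> 0"
  let ?d = "Polynomial.degree P"
  have "hasse ?d P = (\<Sum>i\<in>{?d}. Polynomial.monom (of_nat (i choose ?d) * poly.coeff P i) (i - ?d))"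
    unfolding hasse_def by (rule sum.mono_neutral_right) (auto simp: binomial_eq_0)
  then show ?thesis using P by simp
qed

context subring_set
begin

lemma hasse_polys_over: "P \<in> polys_over R \<Longrightarrow> hasse k P \<in> polys_over R"
  unfolding hasse_def by (intro polys_over_mems subring_mems polys_overD)

end

subsection \<open>Hensel's lemma for reductions with two terms\<close>

lemma poly_pderiv_1: "poly (pderiv Q) 1 = (\<Sum>i\<le>Polynomial.degree Q. of_nat i * poly.coeff Q i)"
  for Q :: "'a::field poly"
proof -
  have "pderiv Q = (\<Sum>i\<le>Polynomial.degree Q. pderiv (Polynomial.monom (poly.coeff Q i) i))"
    by (subst poly_as_sum_of_monoms[symmetric]) (simp add: pderiv_sum)
  then show ?thesis by (simp add: pderiv_monom poly_sum poly_monom)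
qed

locale henselian_extension = valued_extension +
  assumes hensel: "henselian K v"
    and prime_char: "Factorial_Ring.prime CHAR('a)"
begin

text \<open>
  The reduction of \<open>g\<close> is \<open>Y\<^sup>k + g(0)\<close>, and \<open>1\<close> is a simple root of it because \<open>k\<close> is prime to the
  characteristic. The leading coefficient of \<open>g\<close> may well be in the maximal ideal. But \<open>g(0)\<close> is
  congruent to \<open>- 1\<close>, so the reciprocal polynomial becomes monic after division by a unit, and the
  inverse of the root that Hensel's lemma gives for it is a root of \<open>g\<close>.
\<close>

lemma hensel_root:
  assumes g: "g \<in> polys_over A"
    and k: "0 < k" "k < CHAR('a)" "poly.coeff g k = 1"
    and small: "\<And>i. i \<noteq> 0 \<Longrightarrow> i \<noteq> k \<Longrightarrow> poly.coeff g i \<in> vgt 0"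
    and root: "poly g 1 \<in> vgt 0"
  shows "\<exists>y\<in>K. poly g y = 0"
proof -
  interpret A: subring_set A by (rule A_subring)
  interpret pr: prime_residues A "vge 0" "vgt 0" by (rule prime_residues_valuation)
  let ?d = "Polynomial.degree g"
  have kd: "k \<le> ?d" using k(3) by (metis Polynomial.le_degree zero_neq_one)
  define a where "a = poly.coeff g 0"
  have g1: "poly g 1 = a + (1 + (\<Sum>i\<in>{..?d} - {0, k}. poly.coeff g i))"
  proof -
    have "poly g 1 = (\<Sum>i\<in>{..?d}. poly.coeff g i)" by (simp add: poly_altdef)
    also have "\<dots> = (\<Sum>i\<in>{0, k}. poly.coeff g i) + (\<Sum>i\<in>{..?d} - {0, k}. poly.coeff g i)"
      using kd by (subst sum.subset_diff[of "{0, k}"]) (auto simp: add.commute)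
    also have "(\<Sum>i\<in>{0, k}. poly.coeff g i) = a + 1"
      using k by (simp add: a_def)
    finally show ?thesis by (simp add: add.assoc)
  qed
  have aK: "a \<in> A" using g unfolding a_def by (rule polys_overD)
  have rest: "(\<Sum>i\<in>{..?d} - {0, k}. poly.coeff g i) \<in> vgt 0"
    by (intro vgt_sum small) auto
  have a1: "- 1 - a \<in> vgt 0"
  proof -
    have "- 1 - a = (\<Sum>i\<in>{..?d} - {0, k}. poly.coeff g i) - poly g 1" by (simp add: g1)
    then show ?thesis using vgt_diff[OF rest root] by simp
  qed
  have anz: "a \<noteq> 0" and va: "v a = 0"
    using v_cong[of "- 1" a] vgt_uminus[OF a1] by auto
  define h where "h = Polynomial.smult (inverse a) (reflect_poly g)"
  have ia: "inverse a \<in> A" using aK anz va by (auto simp: vge_iff v_inverse K.inverse_mem)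
  have rg: "reflect_poly g \<in> polys_over A"
    using g A.zero_mem by (auto simp: polys_over_def coeff_reflect_poly)
  have hA: "h \<in> polys_over A"
    unfolding h_def using ia rg by (rule A.smult_polys_over)
  have dr: "Polynomial.degree (reflect_poly g) = ?d"
    using anz unfolding a_def by (rule degree_reflect_poly_eq)
  have lead: "Polynomial.lead_coeff h = 1"
    using anz by (simp add: h_def dr coeff_reflect_poly a_def)
  have h1: "poly h 1 = inverse a * poly g 1"
    unfolding h_def using poly_reflect_poly_nz[of 1 g] by simp
  have h1': "poly h 1 \<in> vgt 0" unfolding h1 using ia root by (intro pr.I_mult) auto
  have deriv: "poly (pderiv (reflect_poly g)) 1
      = of_nat ?d * poly g 1 - (of_nat k + (\<Sum>i\<in>{..?d} - {0, k}. of_nat i * poly.coeff g i))"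
  proof -
    have "poly (pderiv (reflect_poly g)) 1 = (\<Sum>i\<le>?d. of_nat i * poly.coeff g (?d - i))"
      unfolding poly_pderiv_1 dr by (intro sum.cong) (auto simp: coeff_reflect_poly)
    also have "\<dots> = (\<Sum>i\<le>?d. of_nat (?d - i) * poly.coeff g i)"
      by (rule sum.reindex_bij_witness[of _ "\<lambda>i. ?d - i" "\<lambda>i. ?d - i"]) auto
    also have "\<dots> = (\<Sum>i\<le>?d. of_nat ?d * poly.coeff g i - of_nat i * poly.coeff g i)"
      by (intro sum.cong) (auto simp: algebra_simps of_nat_diff)
    also have "\<dots> = of_nat ?d * poly g 1 - (\<Sum>i\<in>{..?d}. of_nat i * poly.coeff g i)"
      by (simp add: sum_subtractf poly_altdef sum_distrib_left)
    also have "(\<Sum>i\<in>{..?d}. of_nat i * poly.coeff g i)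
        = (\<Sum>i\<in>{0, k}. of_nat i * poly.coeff g i) + (\<Sum>i\<in>{..?d} - {0, k}. of_nat i * poly.coeff g i)"
      using kd by (subst sum.subset_diff[of "{0, k}"]) (auto simp: add.commute)
    also have "(\<Sum>i\<in>{0, k}. of_nat i * poly.coeff g i) = of_nat k"
      using k by simp
    finally show ?thesis .
  qed
  have "poly (pderiv (reflect_poly g)) 1 - (- of_nat k) \<in> vgt 0"
  proof -
    have "(\<Sum>i\<in>{..?d} - {0, k}. of_nat i * poly.coeff g i) \<in> vgt 0"
      by (intro vgt_sum pr.I_mult pr.R.of_nat_mem small) auto
    from vgt_diff[OF pr.I_mult[OF pr.R.of_nat_mem[of ?d] root] this] show ?thesis
      unfolding deriv by (simp add: algebra_simps)
  qed
  then have der: "poly (pderiv (reflect_poly g)) 1 \<noteq> 0" "v (poly (pderiv (reflect_poly g)) 1) = 0"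
    using v_cong[of "- of_nat k" "poly (pderiv (reflect_poly g)) 1"] of_nat_unit[OF prime_char k(1,2)]
    by auto
  have "poly (pderiv h) 1 \<notin> vgt 0"
    using der anz va by (simp add: h_def pderiv_smult vgt_iff v_mult v_inverse)
  then obtain z where z: "z \<in> K" "poly h z = 0" "z - 1 \<in> vgt 0"
    using hensel[unfolded henselian_def, rule_format, of 1 h] lead hA h1' A.one_mem A.poly_mem
    by (auto simp: valuation_ring_eq valuation_ideal_eq polys_over_def)
  have znz: "z \<noteq> 0" using z(3) v_cong(1)[of 1 z] by auto
  have "poly (reflect_poly g) z = 0" using z anz by (simp add: h_def)
  then have "poly g (inverse z) = 0"
    using znz by (simp add: poly_reflect_poly_nz)
  then show ?thesis using z K.inverse_mem by blast
qed

end

subsection \<open>Values of polynomials of small degree\<close>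

locale no_best_approximation = henselian_extension v K
  for v :: "'a::field \<Rightarrow> 'g::linordered_ab_group_add" and K +
  fixes \<alpha> :: 'a
  assumes alpha_notin: "\<alpha> \<notin> K"
    and no_max: "c \<in> K \<Longrightarrow> \<exists>c'\<in>K. v (\<alpha> - c) < v (\<alpha> - c')"
begin

text \<open>
  The filter of approximations: a property holds eventually if it holds for all \<open>c \<in> K\<close> that are at least
  as close to \<open>\<alpha>\<close> as some \<open>c0\<close>. It takes the place of a pseudo-Cauchy sequence in \<open>K\<close> with limit \<open>\<alpha>\<close>.
\<close>

definition near :: "'a filter" where
  "near = (INF c0\<in>K. principal {c\<in>K. v (\<alpha> - c0) \<le> v (\<alpha> - c)})"

lemma eventually_near:
  "eventually Q near \<longleftrightarrow> (\<exists>c0\<in>K. \<forall>c\<in>K. v (\<alpha> - c0) \<le> v (\<alpha> - c) \<longrightarrow> Q c)"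
proof -
  have "eventually Q near \<longleftrightarrow>
      (\<exists>c0\<in>K. eventually Q (principal {c\<in>K. v (\<alpha> - c0) \<le> v (\<alpha> - c)}))"
    unfolding near_def
  proof (rule eventually_INF_base)
    show "K \<noteq> {}" using K.one_mem by blast
    fix a b assume ab: "a \<in> K" "b \<in> K"
    show "\<exists>x\<in>K. principal {c \<in> K. v (\<alpha> - x) \<le> v (\<alpha> - c)}
      \<le> inf (principal {c \<in> K. v (\<alpha> - a) \<le> v (\<alpha> - c)}) (principal {c \<in> K. v (\<alpha> - b) \<le> v (\<alpha> - c)})"
    proof (cases "v (\<alpha> - a) \<le> v (\<alpha> - b)")
      case True
      then have "principal {c \<in> K. v (\<alpha> - b) \<le> v (\<alpha> - c)} \<le> principal {c \<in> K. v (\<alpha> - a) \<le> v (\<alpha> - c)}"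
        unfolding principal_le_iff using order.trans by blast
      then show ?thesis using ab(2) by (intro bexI[of _ b]) simp_all
    next
      case False
      then have "v (\<alpha> - b) \<le> v (\<alpha> - a)" by simp
      then have "principal {c \<in> K. v (\<alpha> - a) \<le> v (\<alpha> - c)} \<le> principal {c \<in> K. v (\<alpha> - b) \<le> v (\<alpha> - c)}"
        unfolding principal_le_iff using order.trans by blast
      then show ?thesis using ab(1) by (intro bexI[of _ a]) simp_all
    qed
  qed
  then show ?thesis unfolding eventually_principal by blast
qed

lemma eventually_near_K: "eventually (\<lambda>c. c \<in> K) near"
  unfolding eventually_near using K.one_mem by auto

lemma eventually_closer:
  assumes "c1 \<in> K"
  shows "eventually (\<lambda>c. c \<in> K \<and> v (\<alpha> - c1) < v (\<alpha> - c)) near"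
  using no_max[OF assms] unfolding eventually_near by (auto intro: less_le_trans)

lemma alpha_minus_nz: "c \<in> K \<Longrightarrow> \<alpha> - c \<noteq> 0"
  using alpha_notin by auto

lemma v_diff_closer:
  assumes "c \<in> K" "c' \<in> K" "v (\<alpha> - c) < v (\<alpha> - c')"
  shows "c' - c \<noteq> 0" "v (c' - c) = v (\<alpha> - c)"
  using v_diff_eq[of "\<alpha> - c" "\<alpha> - c'"] assms alpha_minus_nz by (auto simp: vgt_iff)

text \<open>
  The difference of the two sides is strictly monotone in \<open>v (\<alpha> - c)\<close>, whose values have no maximum.
  Hence it changes its sign at most once and does not remain zero.
\<close>

lemma eventually_nsmul_order:
  assumes "j < k"
  shows "eventually (\<lambda>c. b + nsmul j (v (\<alpha> - c)) < b' + nsmul k (v (\<alpha> - c))) near \<or>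
         eventually (\<lambda>c. b' + nsmul k (v (\<alpha> - c)) < b + nsmul j (v (\<alpha> - c))) near"
proof -
  obtain m where m: "k = j + m" "0 < m" using assms less_imp_add_positive by blast
  have *: "b + nsmul j g < b' + nsmul k g \<longleftrightarrow> b < b' + nsmul m g"
    "b' + nsmul k g < b + nsmul j g \<longleftrightarrow> b' + nsmul m g < b" for g
  proof -
    have e: "b' + nsmul k g = nsmul j g + (b' + nsmul m g)"
      by (simp add: m nsmul_add add.left_commute)
    show "b + nsmul j g < b' + nsmul k g \<longleftrightarrow> b < b' + nsmul m g"
      "b' + nsmul k g < b + nsmul j g \<longleftrightarrow> b' + nsmul m g < b"
      unfolding e add.commute[of b "nsmul j g"] by (simp_all only: add_less_cancel_left)
  qed
  show ?thesis
  proof (cases "\<exists>c1\<in>K. b \<le> b' + nsmul m (v (\<alpha> - c1))")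
    case True
    then obtain c1 where c1: "c1 \<in> K" "b \<le> b' + nsmul m (v (\<alpha> - c1))" by blast
    have "eventually (\<lambda>c. b + nsmul j (v (\<alpha> - c)) < b' + nsmul k (v (\<alpha> - c))) near"
      using eventually_closer[OF c1(1)]
    proof eventually_elim
      case (elim c)
      then have "nsmul m (v (\<alpha> - c1)) < nsmul m (v (\<alpha> - c))" using m nsmul_strict_mono by blast
      then show ?case unfolding * using c1(2) by (meson add_strict_left_mono le_less_trans)
    qed
    then show ?thesis ..
  next
    case False
    have "eventually (\<lambda>c. b' + nsmul k (v (\<alpha> - c)) < b + nsmul j (v (\<alpha> - c))) near"
      using eventually_near_K by eventually_elim (use False in \<open>auto simp: *\<close>)
    then show ?thesis ..
  qed
qed

lemma eventually_least:
  assumes "finite S" "S \<noteq> {}"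
    and "\<And>j k. j \<in> S \<Longrightarrow> k \<in> S \<Longrightarrow> j < k \<Longrightarrow>
      eventually (\<lambda>c. T j c < (T k c :: 'g)) near \<or> eventually (\<lambda>c. T k c < T j c) near"
  shows "\<exists>k0\<in>S. \<forall>k\<in>S - {k0 :: nat}. eventually (\<lambda>c. T k0 c < T k c) near"
  using assms
proof (induction S rule: finite_ne_induct)
  case (insert x S)
  then obtain k0 where k0: "k0 \<in> S" "\<forall>k\<in>S - {k0}. eventually (\<lambda>c. T k0 c < T k c) near" by auto
  have "x \<noteq> k0" using insert k0 by auto
  then have "x < k0 \<or> k0 < x" by linarith
  then have "eventually (\<lambda>c. T x c < T k0 c) near \<or> eventually (\<lambda>c. T k0 c < T x c) near"
    using insert.prems[of x k0] insert.prems[of k0 x] k0(1) by blast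
  then show ?case
  proof
    assume 1: "eventually (\<lambda>c. T x c < T k0 c) near"
    have "eventually (\<lambda>c. T x c < T k c) near" if "k \<in> insert x S - {x}" for k
    proof (cases "k = k0")
      case False
      with that k0 have "eventually (\<lambda>c. T k0 c < T k c) near" by auto
      with 1 show ?thesis by eventually_elim simp
    qed (use 1 in simp)
    then show ?thesis by blast
  next
    assume 2: "eventually (\<lambda>c. T k0 c < T x c) near"
    then show ?thesis using k0 by (intro bexI[of _ k0]) auto
  qed
qed auto

text \<open>
  Induction on the degree \<open>d\<close>. The polynomials \<open>H\<^sub>k P\<close> for \<open>k \<ge> 1\<close> have eventually constant values
  \<open>b k\<close>, so among the terms \<open>H\<^sub>k P(c) (\<alpha> - c)\<^sup>k\<close>, whose values are \<open>T k c\<close>, one index \<open>k0\<close> eventually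
  gives strictly the smallest value. Passing from \<open>c\<close> to a closer \<open>c'\<close> changes \<open>P(c)\<close> by an element
  of value \<open>T k0 c\<close>. If \<open>v (P(c)) < T k0 c\<close> for one such \<open>c\<close>, the value of \<open>P\<close> is constant from there
  on and is smaller than those of the other terms.
  
  Otherwise \<open>v (P(c)) = T k0 c\<close> for all \<open>c\<close> close to \<open>\<alpha>\<close>, which is strictly increasing. In this case
  \<open>P(c0 + s y)\<close> with \<open>s = c' - c0\<close>, divided by its dominant coefficient, satisfies the hypotheses of
  \<open>hensel_root\<close>, where \<open>k0 \<le> d < p\<close> is used. So \<open>P\<close> has a root \<open>r\<close> in \<open>K\<close>. By induction the cofactor
  of \<open>X - r\<close> has eventually constant value, and so has \<open>c - r\<close>, because \<open>r\<close> is not a best approximation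
  of \<open>\<alpha>\<close>. Hence \<open>P(c)\<close> has eventually constant value, a contradiction.
\<close>

lemma eventually_value_constant:
  assumes "P \<in> polys_over K" "P \<noteq> 0" "Polynomial.degree P < CHAR('a)"
  shows "\<exists>\<beta>. eventually (\<lambda>c. poly P c \<noteq> 0 \<and> v (poly P c) = \<beta> \<and>
           (\<forall>k\<ge>1. poly (hasse k P) c * (\<alpha> - c) ^ k \<in> vgt \<beta>)) near"
  using assms
proof (induction "Polynomial.degree P" arbitrary: P rule: less_induct)
  case less
  note P = less.prems
  let ?d = "Polynomial.degree P"
  show ?case
  proof (cases "?d = 0")
    case True
    then obtain a where "P = [:a:]" by (metis degree_eq_zeroE)
    then show ?thesis using P by (intro exI[of _ "v a"]) (auto simp: hasse_eq_0)
  next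
    case d0: False
    define N where "N = {k \<in> {1..?d}. hasse k P \<noteq> 0}"
    have N: "finite N" "?d \<in> N" using d0 hasse_degree_nonzero P unfolding N_def by auto
    have "\<forall>k\<in>N. \<exists>\<beta>. eventually (\<lambda>c. poly (hasse k P) c \<noteq> 0 \<and> v (poly (hasse k P) c) = \<beta>) near"
    proof
      fix k assume k: "k \<in> N"
      have "Polynomial.degree (hasse k P) < ?d"
        using degree_hasse[of k P] k d0 unfolding N_def by auto
      then obtain \<beta> where "eventually (\<lambda>c. poly (hasse k P) c \<noteq> 0 \<and> v (poly (hasse k P) c) = \<beta> \<and>
           (\<forall>i\<ge>1. poly (hasse i (hasse k P)) c * (\<alpha> - c) ^ i \<in> vgt \<beta>)) near"
        using less.hyps[of "hasse k P"] P k K.hasse_polys_over unfolding N_def by fastforce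
      then have "eventually (\<lambda>c. poly (hasse k P) c \<noteq> 0 \<and> v (poly (hasse k P) c) = \<beta>) near"
        by eventually_elim simp
      then show "\<exists>\<beta>. eventually (\<lambda>c. poly (hasse k P) c \<noteq> 0 \<and> v (poly (hasse k P) c) = \<beta>) near" ..
    qed
    then obtain b where b: "\<And>k. k \<in> N \<Longrightarrow>
        eventually (\<lambda>c. poly (hasse k P) c \<noteq> 0 \<and> v (poly (hasse k P) c) = b k) near"
      by metis
    define T where "T k c = b k + nsmul k (v (\<alpha> - c))" for k c
    obtain k0 where k0: "k0 \<in> N" "\<And>k. k \<in> N - {k0} \<Longrightarrow> eventually (\<lambda>c. T k0 c < T k c) near"
      using eventually_least[of N T] N eventually_nsmul_order unfolding T_def by blast
    have k0': "0 < k0" "k0 \<le> ?d" using k0 unfolding N_def by auto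
    have "eventually (\<lambda>c. \<forall>k\<in>N. poly (hasse k P) c \<noteq> 0 \<and> v (poly (hasse k P) c) = b k) near"
      using N b by (intro eventually_ball_finite) auto
    moreover have "eventually (\<lambda>c. \<forall>k\<in>N - {k0}. T k0 c < T k c) near"
      using N k0 by (intro eventually_ball_finite) auto
    ultimately have "eventually (\<lambda>c. (\<forall>k\<in>N. poly (hasse k P) c \<noteq> 0 \<and> v (poly (hasse k P) c) = b k)
        \<and> (\<forall>k\<in>N - {k0}. T k0 c < T k c)) near"
      by (rule eventually_conj)
    then obtain c0 where c0: "c0 \<in> K" and
      good: "\<And>c k. c \<in> K \<Longrightarrow> v (\<alpha> - c0) \<le> v (\<alpha> - c) \<Longrightarrow> k \<in> N \<Longrightarrow>
         poly (hasse k P) c \<noteq> 0 \<and> v (poly (hasse k P) c) = b k"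
      "\<And>c k. c \<in> K \<Longrightarrow> v (\<alpha> - c0) \<le> v (\<alpha> - c) \<Longrightarrow> k \<in> N - {k0} \<Longrightarrow> T k0 c < T k c"
      unfolding eventually_near by blast
    let ?t = "T k0"
    have t_strict: "?t c < ?t c'" if "v (\<alpha> - c) < v (\<alpha> - c')" for c c'
      unfolding T_def using nsmul_strict_mono[OF that k0'(1)] by simp
    have t_mono: "?t c \<le> ?t c'" if "v (\<alpha> - c) \<le> v (\<alpha> - c')" for c c'
      unfolding T_def using nsmul_mono[OF that] by simp
    have T_least: "?t c \<le> T k c" if "c \<in> K" "v (\<alpha> - c0) \<le> v (\<alpha> - c)" "k \<in> N" for c k
      using good(2)[OF that(1,2), of k] that(3) by (cases "k = k0") auto
    have not_N: "hasse k P = 0" if "1 \<le> k" "k \<notin> N" for k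
      using that hasse_eq_0[of P k] unfolding N_def by auto
    have term_ge: "poly (hasse k P) c * x ^ k \<in> vge (?t c)"
      if "c \<in> K" "v (\<alpha> - c0) \<le> v (\<alpha> - c)" "x \<in> vge (v (\<alpha> - c))" "1 \<le> k" for c x k
    proof (cases "k \<in> N \<and> x \<noteq> 0")
      case True
      then have val: "v (poly (hasse k P) c * x ^ k) = b k + nsmul k (v x)"
        using good(1)[OF that(1,2), of k] by (simp add: v_mult v_power)
      have "nsmul k (v (\<alpha> - c)) \<le> nsmul k (v x)"
        using True that(3) by (intro nsmul_mono) (simp add: vge_iff)
      then have "T k c \<le> v (poly (hasse k P) c * x ^ k)"
        unfolding val T_def by simp
      moreover have "?t c \<le> T k c" using T_least[OF that(1,2)] True by blast
      ultimately have "?t c \<le> v (poly (hasse k P) c * x ^ k)"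
        by (rule order.trans[rotated])
      then show ?thesis unfolding vge_def by blast
    next
      case False
      then have "poly (hasse k P) c * x ^ k = 0" using not_N[OF that(4)] that(4) by auto
      then show ?thesis by (simp only: zero_vge)
    qed
    have sum_ge: "poly P (c + x) - poly P c \<in> vge (?t c)"
      if "c \<in> K" "v (\<alpha> - c0) \<le> v (\<alpha> - c)" "x \<in> vge (v (\<alpha> - c))" for c x
      unfolding taylor_expansion' using term_ge[OF that] by (auto intro: vge_sum)
    have term_gt: "poly (hasse k P) c * x ^ k \<in> vgt (?t c)"
      if "c \<in> K" "v (\<alpha> - c0) \<le> v (\<alpha> - c)" "x \<noteq> 0" "v x = v (\<alpha> - c)" "1 \<le> k" "k \<noteq> k0" for c x k
    proof (cases "k \<in> N")
      case True
      then have "v (poly (hasse k P) c * x ^ k) = T k c"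
        using good(1)[OF that(1,2), of k] that by (simp add: v_mult v_power T_def)
      then show ?thesis using good(2)[OF that(1,2), of k] True that(6) by (auto simp: vgt_def)
    next
      case False
      then show ?thesis using not_N[OF that(5)] by auto
    qed
    have main_term: "poly (hasse k0 P) c * x ^ k0 \<noteq> 0" "v (poly (hasse k0 P) c * x ^ k0) = ?t c"
      if "c \<in> K" "v (\<alpha> - c0) \<le> v (\<alpha> - c)" "x \<noteq> 0" "v x = v (\<alpha> - c)" for c x
      using good(1)[OF that(1,2) k0(1)] that by (auto simp: v_mult v_power T_def)
    show ?thesis
    proof (cases "\<exists>c\<in>K. v (\<alpha> - c0) \<le> v (\<alpha> - c) \<and> poly P c \<notin> vge (?t c)")
      case True
      then obtain c where c: "c \<in> K" "v (\<alpha> - c0) \<le> v (\<alpha> - c)" "poly P c \<notin> vge (?t c)" by blast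
      then have Pc: "poly P c \<noteq> 0" "v (poly P c) < ?t c" by (auto simp: vge_def)
      have "poly P c' \<noteq> 0 \<and> v (poly P c') = v (poly P c) \<and>
           (\<forall>k\<ge>1. poly (hasse k P) c' * (\<alpha> - c') ^ k \<in> vgt (v (poly P c)))"
        if c': "c' \<in> K" "v (\<alpha> - c) \<le> v (\<alpha> - c')" for c'
      proof -
        have "\<alpha> - c' \<in> vge (v (\<alpha> - c))"
          using c'(2) by (simp add: vge_def)
        from vge_diff[OF vge_self[of "\<alpha> - c"] this] have "c' - c \<in> vge (v (\<alpha> - c))" by simp
        from sum_ge[OF c(1,2) this] have "poly P c' - poly P c \<in> vge (?t c)" by simp
        then have "poly P c' - poly P c \<in> vgt (v (poly P c))"
          by (rule subsetD[OF vge_subset_vgt[OF Pc(2)]])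
        note Pc' = v_cong[OF Pc(1) this]
        have c0': "v (\<alpha> - c0) \<le> v (\<alpha> - c')" using c(2) c'(2) by (rule order.trans)
        have "v (poly P c) < ?t c'" using Pc(2) t_mono[OF c'(2)] by (rule less_le_trans)
        note gt = subsetD[OF vge_subset_vgt[OF this]]
        show ?thesis
          using Pc' gt[OF term_ge[OF c'(1) c0' vge_self]] by simp
      qed
      then show ?thesis unfolding eventually_near by (intro exI[of _ "v (poly P c)"] bexI[OF _ c(1)]) simp
    next
      case False
      then have bad: "poly P c \<in> vge (?t c)" if "c \<in> K" "v (\<alpha> - c0) \<le> v (\<alpha> - c)" for c
        using that by blast
      obtain c' where c': "c' \<in> K" "v (\<alpha> - c0) < v (\<alpha> - c')" using no_max[OF c0] by blast
      define s where "s = c' - c0"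
      have s: "s \<noteq> 0" "v s = v (\<alpha> - c0)" "s \<in> K"
        using v_diff_closer[OF c0 c'] c' c0 K.diff_mem unfolding s_def by auto
      define m where "m = poly (hasse k0 P) c0 * s ^ k0"
      have m: "m \<noteq> 0" "v m = ?t c0" "m \<in> K"
        using main_term[OF c0 order.refl s(1,2)] K.poly_mem[OF K.hasse_polys_over[OF P(1)] c0] s
        unfolding m_def by (auto intro: K.subring_mems)
      \<comment> \<open>the polynomial \<open>P(c0 + s y)\<close> in \<open>y\<close>, normalized at its dominant coefficient \<open>m\<close>\<close>
      define g where "g = (\<Sum>k\<le>?d. Polynomial.monom (poly (hasse k P) c0 * s ^ k / m) k)"
      have coeff_g: "poly.coeff g k = poly (hasse k P) c0 * s ^ k / m" for k
      proof -
        have "poly.coeff g k = (if k \<le> ?d then poly (hasse k P) c0 * s ^ k / m else 0)"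
          by (simp add: g_def Polynomial.coeff_sum)
        then show ?thesis by (simp add: hasse_eq_0)
      qed
      have poly_g: "poly g y = poly P (c0 + s * y) / m" for y
        by (simp add: g_def poly_sum poly_monom taylor_expansion power_mult_distrib mult_ac sum_divide_distrib)
      have scale: "x / m \<in> vgt 0" if "x \<in> vgt (?t c0)" for x
        using that m by (cases "x = 0") (auto simp: vgt_iff v_divide)
      have scale': "x / m \<in> vge 0" if "x \<in> vge (?t c0)" for x
        using that m by (cases "x = 0") (auto simp: vge_iff v_divide)
      have "g \<in> polys_over A"
      proof (rule polys_overI)
        fix i
        have "poly (hasse i P) c0 * s ^ i \<in> vge (?t c0)"
          using bad[OF c0 order.refl] term_ge[OF c0 order.refl, of s i] s vge_self[of s]
          by (cases "i = 0") (auto simp: hasse_0)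
        then show "poly.coeff g i \<in> A"
          unfolding coeff_g using scale' s m c0 P(1)
          by (auto intro!: K.subfield_mems K.poly_mem K.hasse_polys_over)
      qed
      moreover have "poly.coeff g k0 = 1" using m by (simp add: coeff_g m_def)
      moreover have "poly.coeff g i \<in> vgt 0" if "i \<noteq> 0" "i \<noteq> k0" for i
        unfolding coeff_g using term_gt[OF c0 order.refl s(1,2), of i] that by (intro scale) auto
      moreover have "poly g 1 \<in> vgt 0"
        unfolding poly_g s_def using bad[OF c'(1)] c'(2) vge_subset_vgt[OF t_strict[OF c'(2)]]
        by (intro scale) auto
      ultimately obtain y where y: "y \<in> K" "poly g y = 0"
        using hensel_root[of g k0] k0' P(3) by auto
      define r where "r = c0 + s * y"
      have r: "r \<in> K" "poly P r = 0"
        using y m s c0 unfolding r_def poly_g by (auto intro: K.subring_mems)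
      define P1 where "P1 = synthetic_div P r"
      have Peq: "P = [:- r, 1:] * P1"
        using synthetic_div_correct'[of r P] r unfolding P1_def by simp
      have P1: "P1 \<in> polys_over K" "P1 \<noteq> 0" "Polynomial.degree P1 < ?d"
        using K.synthetic_div_polys_over[OF r(1) P(1)] d0 unfolding P1_def
        by (auto simp: synthetic_div_eq_0_iff degree_synthetic_div)
      then obtain \<beta>1 where "eventually (\<lambda>c. poly P1 c \<noteq> 0 \<and> v (poly P1 c) = \<beta>1 \<and>
           (\<forall>i\<ge>1. poly (hasse i P1) c * (\<alpha> - c) ^ i \<in> vgt \<beta>1)) near"
        using less.hyps[of P1] P by fastforce
      then have "eventually (\<lambda>c. poly P c \<noteq> 0 \<and> v (poly P c) = v (\<alpha> - r) + \<beta>1) near"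
        using eventually_closer[OF r(1)]
      proof eventually_elim
        case (elim c)
        then have "poly P c = (c - r) * poly P1 c" "c - r \<noteq> 0" "v (c - r) = v (\<alpha> - r)"
          using v_diff_closer[OF r(1), of c] by (auto simp: Peq algebra_simps)
        then show ?case using elim by (simp add: v_mult)
      qed
      then have "eventually (\<lambda>c. c \<in> K \<and> v (\<alpha> - c0) < v (\<alpha> - c) \<and> v (poly P c) = v (\<alpha> - r) + \<beta>1) near"
        using eventually_closer[OF c0] by eventually_elim simp
      then obtain c1 where c1: "c1 \<in> K" and const: "\<And>c. c \<in> K \<Longrightarrow> v (\<alpha> - c1) \<le> v (\<alpha> - c) \<Longrightarrow>
          v (\<alpha> - c0) < v (\<alpha> - c) \<and> v (poly P c) = v (\<alpha> - r) + \<beta>1"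
        unfolding eventually_near by blast
      \<comment> \<open>\<open>P(c')\<close> has a larger value than the change from \<open>P(c)\<close> to \<open>P(c')\<close>, which therefore
        has the value of \<open>P(c)\<close>\<close>
      have value_eq: "v (poly P c) = ?t c" if c: "c \<in> K" "v (\<alpha> - c0) \<le> v (\<alpha> - c)" for c
      proof -
        obtain c' where c': "c' \<in> K" "v (\<alpha> - c) < v (\<alpha> - c')" using no_max[OF c(1)] by blast
        let ?x = "c' - c"
        have x: "?x \<noteq> 0" "v ?x = v (\<alpha> - c)" using v_diff_closer[OF c(1) c'] by auto
        let ?m = "poly (hasse k0 P) c * ?x ^ k0"
        let ?rest = "\<Sum>k\<in>{1..?d} - {k0}. poly (hasse k P) c * ?x ^ k"
        have split: "(\<Sum>k\<in>{1..?d}. poly (hasse k P) c * ?x ^ k) = ?m + ?rest"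
          using k0' by (intro sum.remove) auto
        have "c + ?x = c'" by simp
        then have "poly P c' = poly P c + (?m + ?rest)"
          using taylor_expansion'[of P c ?x] unfolding split by metis
        then have eq: "poly P c - (- ?m) = poly P c' - ?rest" by (simp add: algebra_simps)
        have "poly P c' \<in> vgt (?t c)"
          using bad[OF c'(1)] c'(2) c(2) vge_subset_vgt[OF t_strict[OF c'(2)]] by force
        then have "poly P c' - ?rest \<in> vgt (?t c)"
          by (rule vgt_diff) (auto intro!: vgt_sum term_gt[OF c x])
        then show ?thesis
          using v_cong[of "- ?m" "poly P c"] main_term[OF c x] unfolding eq by simp
      qed
      obtain c2 where c2: "c2 \<in> K" "v (\<alpha> - c1) < v (\<alpha> - c2)" using no_max[OF c1] by blast
      have "?t c1 = ?t c2"
        using const[OF c1] const[OF c2(1)] c2 value_eq[OF c1] value_eq[OF c2(1)] by auto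
      with t_strict[OF c2(2)] show ?thesis by simp
    qed
  qed
qed

end

section \<open>Spans of powers\<close>

lemma ambient_simps [simp]:
  "carrier (ambient :: 'a::field ring) = UNIV"
  "monoid.mult (ambient :: 'a::field ring) = (*)"
  "add (ambient :: 'a::field ring) = (+)"
  "monoid.one (ambient :: 'a::field ring) = 1"
  "ring.zero (ambient :: 'a::field ring) = 0"
  by (simp_all add: ring_of_type_algebra_def fun_eq_iff)

lemma ring_ambient: "ring (ambient :: 'a::field ring)"
  and field_ambient: "field (ambient :: 'a::field ring)"
  by (rule ring_from_type_algebra field_from_type_algebra)+

lemma a_inv_ambient: "a_inv ambient x = - (x :: 'a::field)"
proof -
  interpret ring "ambient :: 'a ring" by (rule ring_ambient)
  show ?thesis by (rule minus_equality) auto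
qed

lemma subring_set_iff: "subring_set R \<longleftrightarrow> subring R (ambient :: 'a::field ring)"
proof
  interpret ring "ambient :: 'a ring" by (rule ring_ambient)
  show "subring R (ambient :: 'a ring)" if "subring_set R"
  proof -
    interpret subring_set R by fact
    show ?thesis by (rule subringI) (auto simp: a_inv_ambient intro: subring_mems)
  qed
  show "subring_set R" if "subring R (ambient :: 'a ring)"
  proof
    fix x y assume "x \<in> R" "y \<in> R"
    then show "x - y \<in> R"
      using subringE(7)[OF that, of x "- y"] subringE(5)[OF that, of y] by (simp add: a_inv_ambient)
  qed (use subringE[OF that] in auto)
qed

lemma subfield_set_of_subfield:
  assumes "subfield K (ambient :: 'a::field ring)"
  shows "subfield_set K"
proof -
  interpret ring "ambient :: 'a ring" by (rule ring_ambient)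
  interpret subring_set K using subfieldE(1)[OF assms] subring_set_iff by blast
  show ?thesis
  proof
    fix x assume x: "x \<in> K"
    show "inverse x \<in> K"
    proof (cases "x = 0")
      case False
      then have "x * m_inv ambient x = 1" "m_inv ambient x \<in> K"
        using subfield_m_inv[OF assms, of x] x by auto
      then show ?thesis by (metis inverse_unique)
    qed (use x in simp)
  qed
qed

lemma poly_as_lessThan_sum:
  assumes "Polynomial.degree P < n"
  shows "poly P (u :: 'a::field) = (\<Sum>i<n. poly.coeff P i * u ^ i)"
  unfolding poly_altdef
  by (rule sum.mono_neutral_left) (use assms in \<open>auto simp: Polynomial.coeff_eq_0\<close>)

text \<open>
  A homomorphism from a subring of \<open>L\<close> that serves to transport polynomial expressions into the vector
  space notions over \<open>F\<close>. It is the identity of \<open>L\<close> for the extension \<open>L|K\<close>, and the reduction modulo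
  the maximal ideal for the extension of residue fields.
\<close>

locale residue_map = F: ring F + R: subring_set R
  for F :: "'b ring" and R :: "'a::field set" +
  fixes h :: "'a \<Rightarrow> 'b"
  assumes hom: "h \<in> Ring.ring_hom (ambient\<lparr>carrier := R\<rparr>) F"
begin

lemma hom_simps:
  "x \<in> R \<Longrightarrow> h x \<in> carrier F"
  "x \<in> R \<Longrightarrow> y \<in> R \<Longrightarrow> h (x * y) = h x \<otimes>\<^bsub>F\<^esub> h y"
  "x \<in> R \<Longrightarrow> y \<in> R \<Longrightarrow> h (x + y) = h x \<oplus>\<^bsub>F\<^esub> h y"
  "h 1 = \<one>\<^bsub>F\<^esub>"
  using hom by (auto simp: Ring.ring_hom_def)

lemma hom_zero: "h 0 = \<zero>\<^bsub>F\<^esub>"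
proof -
  have "h 0 \<oplus>\<^bsub>F\<^esub> h 0 = h 0" using hom_simps(3)[of 0 0] R.zero_mem by simp
  then show ?thesis using hom_simps(1)[OF R.zero_mem] by (metis F.add.l_cancel_one' F.add.l_cancel_one)
qed

lemma combine_map:
  assumes "set xs \<subseteq> R" "set ys \<subseteq> R"
  shows "F.combine (map h xs) (map h ys) = h (\<Sum>i<min (length xs) (length ys). xs ! i * ys ! i)"
  using assms
proof (induction xs arbitrary: ys)
  case Nil
  then show ?case by (simp add: hom_zero)
next
  case (Cons x xs)
  show ?case
  proof (cases ys)
    case Nil
    then show ?thesis by (simp add: hom_zero)
  next
    case (Cons y ys')
    let ?n = "min (length xs) (length ys')"
    have mem: "(\<Sum>i<?n. xs ! i * ys' ! i) \<in> R"
      using Cons Cons.prems by (intro R.sum_mem R.mult_mem) (auto simp: subset_iff)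
    have "F.combine (map h (x # xs)) (map h ys)
        = h x \<otimes>\<^bsub>F\<^esub> h y \<oplus>\<^bsub>F\<^esub> h (\<Sum>i<?n. xs ! i * ys' ! i)"
      using Cons Cons.IH[of ys'] Cons.prems by simp
    also have "\<dots> = h (x * y + (\<Sum>i<?n. xs ! i * ys' ! i))"
      using mem Cons Cons.prems by (simp add: hom_simps R.mult_mem)
    finally show ?thesis
      using Cons by (simp add: sum.lessThan_Suc_shift min_Suc_Suc del: sum.lessThan_Suc)
  qed
qed

lemma combine_powers:
  assumes "A \<subseteq> R" "set xs \<subseteq> A" "u \<in> R" "subring_set A"
  shows "\<exists>P\<in>polys_over A. (0 < n \<longrightarrow> Polynomial.degree P < n) \<and>
    F.combine (map h xs) (map (\<lambda>i. h (u ^ i)) [0..<n]) = h (poly P u) \<and>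
    (\<forall>i<min (length xs) n. poly.coeff P i = xs ! i)"
proof -
  interpret A: subring_set A by fact
  define m where "m = min (length xs) n"
  define P where "P = (\<Sum>i<m. Polynomial.monom (xs ! i) i)"
  have coeff: "poly.coeff P i = (if i < m then xs ! i else 0)" for i
    unfolding P_def by (simp add: Polynomial.coeff_sum)
  have "F.combine (map h xs) (map h (map (\<lambda>i. u ^ i) [0..<n])) = h (\<Sum>i<m. xs ! i * u ^ i)"
    using assms by (subst combine_map) (auto intro!: R.power_mem simp: m_def)
  then have "F.combine (map h xs) (map (\<lambda>i. h (u ^ i)) [0..<n]) = h (poly P u)"
    by (simp add: o_def P_def poly_sum poly_monom)
  moreover have "P \<in> polys_over A"
    using assms(2) A.zero_mem by (intro polys_overI) (auto simp: coeff m_def)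
  moreover have "Polynomial.degree P < n" if "0 < n"
  proof -
    have "Polynomial.degree P \<le> n - 1"
      by (rule Polynomial.degree_le) (auto simp: coeff m_def)
    with that show ?thesis by simp
  qed
  ultimately show ?thesis using coeff by (auto simp: m_def)
qed

lemma powers_in_carrier: "u \<in> R \<Longrightarrow> set (map (\<lambda>i. h (u ^ i)) [0..<n]) \<subseteq> carrier F"
  by (auto intro!: hom_simps R.power_mem)

lemma list_preimage: "set ys \<subseteq> h ` A \<Longrightarrow> \<exists>xs. set xs \<subseteq> A \<and> ys = map h xs"
proof (induction ys)
  case (Cons y ys)
  then obtain xs x where "set xs \<subseteq> A" "ys = map h xs" "x \<in> A" "y = h x" by auto
  then show ?case by (intro exI[of _ "x # xs"]) auto
qed simp

lemma Span_powers:
  assumes "A \<subseteq> R" "u \<in> R" "subring_set A" "0 < n" "subfield (h ` A) F"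
  shows "F.Span (h ` A) (map (\<lambda>i. h (u ^ i)) [0..<n])
    = {h (poly P u) | P. P \<in> polys_over A \<and> Polynomial.degree P < n}"
proof -
  let ?us = "map (\<lambda>i. h (u ^ i)) [0..<n]"
  have "F.Span (h ` A) ?us
      = {F.combine Ks ?us | Ks. length Ks = length ?us \<and> set Ks \<subseteq> h ` A}"
    using assms powers_in_carrier by (intro F.Span_eq_combine_set_length_version)
  also have "\<dots> = {h (poly P u) | P. P \<in> polys_over A \<and> Polynomial.degree P < n}" (is "?S = ?T")
  proof (intro equalityI subsetI)
    fix x assume "x \<in> ?S"
    then obtain Ks where Ks: "x = F.combine Ks ?us" "set Ks \<subseteq> h ` A" by blast
    then obtain xs where "set xs \<subseteq> A" "Ks = map h xs" using list_preimage by blast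
    then show "x \<in> ?T" using combine_powers[OF assms(1) _ assms(2,3), of xs n] Ks assms(4) by auto
  next
    fix x assume "x \<in> ?T"
    then obtain P where P: "x = h (poly P u)" "P \<in> polys_over A" "Polynomial.degree P < n" by blast
    let ?xs = "map (poly.coeff P) [0..<n]"
    have sub: "set ?xs \<subseteq> A" using P by (auto dest: polys_overD)
    have "F.combine (map h ?xs) (map h (map (\<lambda>i. u ^ i) [0..<n])) = h (\<Sum>i<n. poly.coeff P i * u ^ i)"
      using assms sub by (subst combine_map) (auto intro!: R.power_mem)
    then have "x = F.combine (map h ?xs) ?us"
      using P by (simp add: poly_as_lessThan_sum o_def)
    then show "x \<in> ?S" using sub by (intro CollectI exI[of _ "map h ?xs"]) auto
  qed
  finally show ?thesis .
qed

lemma independent_powers: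
  assumes "A \<subseteq> R" "u \<in> R" "subring_set A" "subfield (h ` A) F" "0 < n"
    and indep: "\<And>P i. P \<in> polys_over A \<Longrightarrow> Polynomial.degree P < n \<Longrightarrow> h (poly P u) = \<zero>\<^bsub>F\<^esub> \<Longrightarrow>
      h (poly.coeff P i) = \<zero>\<^bsub>F\<^esub>"
  shows "F.independent (h ` A) (map (\<lambda>i. h (u ^ i)) [0..<n])"
proof (rule F.trivial_combine_imp_independent[OF assms(4) powers_in_carrier[OF assms(2)]])
  fix Ks assume Ks: "set Ks \<subseteq> h ` A" "F.combine Ks (map (\<lambda>i. h (u ^ i)) [0..<n]) = \<zero>\<^bsub>F\<^esub>"
  then obtain xs where xs: "set xs \<subseteq> A" "Ks = map h xs" using list_preimage by blast
  then obtain P where P: "P \<in> polys_over A" "Polynomial.degree P < n" "h (poly P u) = \<zero>\<^bsub>F\<^esub>"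
    "\<forall>i<min (length xs) n. poly.coeff P i = xs ! i"
    using combine_powers[OF assms(1) xs(1) assms(2,3), of n] Ks assms(5) by auto
  then have "h (xs ! i) = \<zero>\<^bsub>F\<^esub>" if "i < min (length xs) n" for i
    using indep[OF P(1-3), of i] that by simp
  then show "set (take (length (map (\<lambda>i. h (u ^ i)) [0..<n])) Ks) \<subseteq> {\<zero>\<^bsub>F\<^esub>}"
    by (auto simp: xs(2) set_conv_nth)
qed

end

lemma residue_map_ambient: "residue_map (ambient :: 'a::field ring) UNIV id"
proof -
  interpret ring "ambient :: 'a ring" by (rule ring_ambient)
  show ?thesis
    by unfold_locales (auto simp: Ring.ring_hom_def)
qed

context subfield_set
begin

lemma subfield_ambient: "subfield R ambient"
proof -
  interpret field "ambient :: 'a ring" by (rule field_ambient)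
  show ?thesis
  proof (rule subfieldI')
    show "subring R ambient" using subring_set_iff subring_set_axioms by blast
    fix k assume k: "k \<in> R - {\<zero>\<^bsub>ambient\<^esub>}"
    then have "m_inv ambient k = inverse k" by (intro comm_inv_char) auto
    then show "m_inv ambient k \<in> R" using k inverse_mem by simp
  qed
qed

lemma span_of_independent_powers:
  assumes dim: "ring.dimension ambient n R UNIV" and n: "0 < n"
    and indep: "\<And>P. P \<in> polys_over R \<Longrightarrow> Polynomial.degree P < n \<Longrightarrow> poly P u = 0 \<Longrightarrow> P = 0"
  shows "\<exists>P\<in>polys_over R. Polynomial.degree P < n \<and> x = poly P u"
proof -
  interpret residue_map "ambient :: 'a ring" UNIV id by (rule residue_map_ambient)
  note sf = subfield_ambient
  let ?us = "map (\<lambda>i. id (u ^ i)) [0..<n]"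
  have "F.independent (id ` R) ?us"
    by (rule independent_powers) (use indep n sf subring_set_axioms in force)+
  then obtain vs where "length (vs @ ?us) = n" "F.Span R (vs @ ?us) = UNIV"
    using F.complete_base[OF sf dim, of ?us] by auto
  then have "F.Span (id ` R) ?us = UNIV" by simp
  then have "x \<in> F.Span (id ` R) ?us" by simp
  then show ?thesis
    using Span_powers[of R u n] n sf subring_set_axioms by auto
qed

end

section \<open>Artin--Schreier generators\<close>

lemma generate_field_subset:
  assumes "S \<subseteq> generate_field R T"
  shows "generate_field R S \<subseteq> generate_field R T"
proof
  fix x assume "x \<in> generate_field R S"
  then show "x \<in> generate_field R T"
    using assms by (induction rule: generate_field.induct) (auto intro: generate_field.intros)
qed

lemma (in subfield_set) generate_field_self: "generate_field ambient R = R"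
proof
  interpret field "ambient :: 'a ring" by (rule field_ambient)
  show "generate_field ambient R \<subseteq> R"
  proof
    fix x assume "x \<in> generate_field ambient R"
    then show "x \<in> R"
    proof (induction rule: generate_field.induct)
      case (m_inv h)
      then have "m_inv ambient h = inverse h" by (intro comm_inv_char) auto
      then show ?case using m_inv inverse_mem by simp
    qed (auto simp: a_inv_ambient intro: subring_mems)
  qed
qed (auto intro: generate_field.incl)

lemma coeff_linear_poly_power':
  "poly.coeff ([:a, 1:] ^ n) i = of_nat (n choose i) * (a :: 'a::field) ^ (n - i)"
  by (cases "i \<le> n")
    (auto simp: coeff_linear_poly_power binomial_eq_0 Polynomial.coeff_eq_0 degree_linear_power)

lemma power_CHAR_fixed:
  fixes x :: "'a::field"
  assumes "Factorial_Ring.prime CHAR('a)" "x ^ CHAR('a) = x"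
  shows "\<exists>i<CHAR('a). x = of_nat i"
proof -
  have "poly (Polynomial.monom 1 CHAR('a) - [:0 ^ CHAR('a) - 1 ^ (CHAR('a) - 1) * 0, 1 ^ (CHAR('a) - 1):]) x = 0"
    using assms prime_gt_0_nat by (simp add: poly_monom power_0_left)
  then show ?thesis
    unfolding additive_poly_split[OF assms(1) refl one_neq_zero]
    by (auto simp: poly_prod_list o_def prod_list_zero_iff)
qed

lemma power_CHAR_diff:
  fixes x y :: "'a::field"
  assumes "Factorial_Ring.prime CHAR('a)"
  shows "(x - y) ^ CHAR('a) = x ^ CHAR('a) - y ^ CHAR('a)"
  using freshmans_dream[OF assms refl, of "x - y" y] by simp

lemma power_CHAR_of_nat_mult:
  fixes x :: "'a::field"
  assumes "Factorial_Ring.prime CHAR('a)"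
  shows "(of_nat i * x) ^ CHAR('a) = of_nat i * x ^ CHAR('a)"
  by (simp only: power_mult_distrib of_nat_power_CHAR[OF assms])

locale artin_schreier_extension = henselian_extension v K
  for v :: "'a::field \<Rightarrow> 'g::linordered_ab_group_add" and K +
  fixes p :: nat
  assumes p_eq: "p = CHAR('a)" and dim: "ring.dimension ambient p K UNIV"
begin

abbreviation "S \<equiv> AS_generators p K"

lemma p_prime: "Factorial_Ring.prime p" and p_gt_1: "1 < p"
  using prime_char prime_gt_1_nat unfolding p_eq by auto

lemma K_neq_UNIV: "K \<noteq> UNIV"
proof
  interpret ring "ambient :: 'a ring" by (rule ring_ambient)
  assume "K = UNIV"
  then have "dimension 1 K UNIV" using dimension_one[OF K.subfield_ambient] by simp
  then have "p = 1" using dimension_is_inj[OF K.subfield_ambient dim] by blast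
  with p_gt_1 show False by simp
qed

lemma generator_notin: "\<alpha> \<in> S \<Longrightarrow> \<alpha> \<notin> K"
  using K_neq_UNIV K.generate_field_self
  unfolding AS_generators_def generates_def by (auto simp: insert_absorb)

lemma generator_eq: "\<alpha> \<in> S \<Longrightarrow> \<alpha> ^ p - \<alpha> \<in> K"
  unfolding AS_generators_def by auto

lemma generator_shift:
  assumes "\<alpha> \<in> S" "c \<in> K"
  shows "\<alpha> - c \<in> S"
proof -
  have "(\<alpha> - c) ^ p - (\<alpha> - c) = (\<alpha> ^ p - \<alpha>) - (c ^ p - c)"
    using power_CHAR_diff[OF prime_char] by (simp add: p_eq)
  then have "(\<alpha> - c) ^ p - (\<alpha> - c) \<in> K"
    using K.diff_mem[OF generator_eq[OF assms(1)] K.diff_mem[OF K.power_mem[OF assms(2)] assms(2)]]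
    by metis
  moreover have "generates K (\<alpha> - c)"
  proof -
    let ?G = "generate_field ambient (insert (\<alpha> - c) K)"
    have "(\<alpha> - c) \<oplus>\<^bsub>ambient\<^esub> c \<in> ?G"
      using assms by (intro generate_field.eng_add generate_field.incl) auto
    then have "insert \<alpha> K \<subseteq> ?G" by (auto intro: generate_field.incl)
    from generate_field_subset[OF this] show ?thesis
      using assms unfolding AS_generators_def generates_def by auto
  qed
  ultimately show ?thesis unfolding AS_generators_def by auto
qed

text \<open>
  The scaling factor \<open>t\<close> makes this applicable to a generator multiplied by an element of \<open>K\<close>.
\<close>

lemma scaled_powers_independent:
  assumes "u \<notin> K" "t \<in> K" "t \<noteq> 0" "u ^ p - t ^ (p - 1) * u \<in> K"
    and P: "P \<in> polys_over K" "Polynomial.degree P < p" "poly P u = 0"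
  shows "P = 0"
proof -
  interpret prime_residues K UNIV "{0}" by (rule prime_residues_field)
  have "P \<in> polys_over {0}"
    using powers_independent[of p u t "u ^ p - t ^ (p - 1) * u" P] assms prime_char p_eq
    by (auto simp: eq_iff_diff_eq_0[symmetric])
  then show ?thesis by (auto simp: polys_over_def intro: poly_eqI)
qed

lemma scaled_powers_span:
  assumes "u \<notin> K" "t \<in> K" "t \<noteq> 0" "u ^ p - t ^ (p - 1) * u \<in> K"
  shows "\<exists>P\<in>polys_over K. Polynomial.degree P < p \<and> x = poly P u"
  using K.span_of_independent_powers[OF dim _ scaled_powers_independent[OF assms]] p_gt_1 by auto

lemma generator_powers_independent:
  assumes "\<alpha> \<in> S" "P \<in> polys_over K" "Polynomial.degree P < p" "poly P \<alpha> = 0"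
  shows "P = 0"
  using scaled_powers_independent[of \<alpha> 1 P] generator_notin generator_eq assms K.one_mem by simp

lemma generator_powers_span:
  assumes "\<alpha> \<in> S"
  shows "\<exists>P\<in>polys_over K. Polynomial.degree P < p \<and> x = poly P \<alpha>"
  using scaled_powers_span[of \<alpha> 1 x] generator_notin generator_eq assms K.one_mem by simp

lemma scaled_generator_eq:
  assumes "\<alpha> \<in> S" "t \<in> K"
  shows "(t * \<alpha>) ^ p - t ^ (p - 1) * (t * \<alpha>) \<in> K"
proof -
  have tp: "t ^ p = t ^ (p - 1) * t" using p_gt_1 power_minus_mult[of p t] by simp
  have "(t * \<alpha>) ^ p - t ^ (p - 1) * (t * \<alpha>) = t ^ p * (\<alpha> ^ p - \<alpha>)"
    unfolding power_mult_distrib tp by (simp only: right_diff_distrib left_diff_distrib mult_ac)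
  then show ?thesis
    using K.mult_mem[OF K.power_mem[OF assms(2)] generator_eq[OF assms(1)]] by simp
qed

lemma generator_no_root:
  assumes "\<alpha> \<in> S" "c \<in> K"
  shows "c ^ p - c \<noteq> \<alpha> ^ p - \<alpha>"
proof
  assume "c ^ p - c = \<alpha> ^ p - \<alpha>"
  then have "c ^ p = \<alpha> ^ p - \<alpha> + c" by (simp only: diff_eq_eq)
  moreover have "(\<alpha> - c) ^ p = \<alpha> ^ p - c ^ p"
    unfolding p_eq by (rule power_CHAR_diff[OF prime_char])
  ultimately have "(\<alpha> - c) ^ p = \<alpha> - c" by simp
  then obtain i where "\<alpha> - c = of_nat i" using power_CHAR_fixed[OF prime_char] p_eq by blast
  then have "\<alpha> = of_nat i + c" by (simp add: algebra_simps)
  then have "\<alpha> \<in> K" using assms K.add_mem K.of_nat_mem by simp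
  with generator_notin assms show False by blast
qed

text \<open>
  Write \<open>\<alpha>' = P(\<alpha>)\<close>. Raising to the \<open>p\<close>-th power and using \<open>\<alpha>\<^sup>p = \<alpha> + f\<close> turns the equation of \<open>\<alpha>'\<close> into
  \<open>P\<^sup>*(\<alpha> + f) - P(\<alpha>) - f' = 0\<close>, where \<open>P\<^sup>*\<close> has the \<open>p\<close>-th powers of the coefficients of \<open>P\<close>. The
  degree is below \<open>p\<close>, so this is an identity of polynomials \<open>D = 0\<close>. Its top coefficient shows that
  the leading coefficient of \<open>P\<close> is in the prime field. If the degree were at least \<open>2\<close>, the next
  coefficient would give a solution of \<open>c\<^sup>p - c = f\<close> in \<open>K\<close>.
\<close>

lemma generators_related:
  assumes "\<alpha> \<in> S" "\<alpha>' \<in> S"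
  shows "\<exists>i c. 0 < i \<and> i < p \<and> c \<in> K \<and> \<alpha>' = of_nat i * \<alpha> + c"
proof -
  define f where "f = \<alpha> ^ p - \<alpha>"
  define f' where "f' = \<alpha>' ^ p - \<alpha>'"
  have f: "f \<in> K" "f' \<in> K" using generator_eq assms unfolding f_def f'_def by auto
  obtain P where P: "P \<in> polys_over K" "Polynomial.degree P < p" "\<alpha>' = poly P \<alpha>"
    using generator_powers_span[OF assms(1)] by blast
  define d where "d = Polynomial.degree P"
  define a where "a = Polynomial.lead_coeff P"
  have aK: "poly.coeff P i \<in> K" for i using P(1) by (rule polys_overD)
  define D where "D = (\<Sum>j\<le>d. Polynomial.smult (poly.coeff P j ^ p) ([:f, 1:] ^ j)) - P - [:f':]"
  have "d \<noteq> 0"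
  proof
    assume "d = 0"
    then have "\<alpha>' = poly.coeff P 0" using P(3) unfolding d_def by (metis degree_eq_zeroE coeff_pCons_0 poly_const_conv)
    then show False using aK[of 0] generator_notin[OF assms(2)] by simp
  qed
  then have a0: "a \<noteq> 0" unfolding a_def d_def by auto
  have coeff_D: "poly.coeff D i = (\<Sum>j\<le>d. poly.coeff P j ^ p * (of_nat (j choose i) * f ^ (j - i)))
      - poly.coeff P i - (if i = 0 then f' else 0)" for i
    by (simp add: D_def Polynomial.coeff_sum coeff_linear_poly_power' coeff_pCons split: nat.split)
  have "poly D \<alpha> = (\<Sum>j\<le>d. poly.coeff P j ^ p * (\<alpha> ^ p) ^ j) - poly P \<alpha> - f'"
    by (simp add: D_def poly_sum f_def)
  also have "(\<Sum>j\<le>d. poly.coeff P j ^ p * (\<alpha> ^ p) ^ j) = (\<Sum>j\<le>d. (poly.coeff P j * \<alpha> ^ j) ^ p)"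
    by (simp add: power_mult_distrib power_mult[symmetric] mult.commute)
  also have "\<dots> = (poly P \<alpha>) ^ p"
    unfolding poly_altdef d_def p_eq by (rule freshmans_dream_sum[OF prime_char refl, symmetric])
  finally have "poly D \<alpha> = 0" using P(3) by (simp add: f'_def)
  moreover have "D \<in> polys_over K"
  proof (rule polys_overI)
    fix i show "poly.coeff D i \<in> K"
      unfolding coeff_D using f aK K.zero_mem
      by (auto intro!: K.diff_mem K.sum_mem K.mult_mem K.power_mem K.of_nat_mem)
  qed
  moreover have "Polynomial.degree D < p"
  proof -
    have "poly.coeff D i = 0" if "d < i" for i
      unfolding coeff_D using that by (auto simp: binomial_eq_0 Polynomial.coeff_eq_0 d_def)
    then have "Polynomial.degree D \<le> d" by (auto intro: Polynomial.degree_le)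
    then show ?thesis using P(2) unfolding d_def by simp
  qed
  ultimately have D0: "D = 0" using generator_powers_independent[OF assms(1)] by blast
  have "a ^ p = a"
  proof -
    have "(\<Sum>j\<le>d. poly.coeff P j ^ p * (of_nat (j choose d) * f ^ (j - d)))
        = (\<Sum>j\<in>{d}. poly.coeff P j ^ p * (of_nat (j choose d) * f ^ (j - d)))"
      by (rule sum.mono_neutral_right) (auto simp: binomial_eq_0)
    then show ?thesis
      using coeff_D[of d] D0 \<open>d \<noteq> 0\<close> by (simp add: a_def d_def)
  qed
  then obtain i where i: "i < p" "a = of_nat i"
    using power_CHAR_fixed[OF prime_char] p_eq by blast
  have "d = 1"
  proof (rule ccontr)
    assume "d \<noteq> 1"
    define e where "e = d - 1"
    have e: "d = Suc e" "e \<noteq> 0" using \<open>d \<noteq> 0\<close> \<open>d \<noteq> 1\<close> unfolding e_def by auto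
    define b where "b = poly.coeff P e"
    have "(\<Sum>j\<le>d. poly.coeff P j ^ p * (of_nat (j choose e) * f ^ (j - e)))
        = (\<Sum>j\<in>{e, d}. poly.coeff P j ^ p * (of_nat (j choose e) * f ^ (j - e)))"
      by (rule sum.mono_neutral_right) (auto simp: binomial_eq_0 e(1))
    also have "\<dots> = b ^ p + poly.coeff P d ^ p * (of_nat (d choose e) * f ^ (d - e))"
      unfolding b_def using e(1) by (subst sum.insert) simp_all
    also have "poly.coeff P d ^ p = a"
      using \<open>a ^ p = a\<close> unfolding a_def d_def .
    also have "(of_nat (d choose e) :: 'a) * f ^ (d - e) = of_nat d * f"
      unfolding e(1) by simp
    finally have sum_eq: "(\<Sum>j\<le>d. poly.coeff P j ^ p * (of_nat (j choose e) * f ^ (j - e)))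
        = b ^ p + a * (of_nat d * f)" .
    have b: "b ^ p + a * (of_nat d * f) - b = 0"
      using coeff_D[of e] e(2) unfolding sum_eq D0 b_def[symmetric] by simp
    obtain m where m: "of_nat m * (of_nat d :: 'a) = 1"
      using of_nat_inverse_CHAR[OF prime_char, of d] \<open>d \<noteq> 0\<close> P(2) unfolding d_def p_eq by auto
    obtain k where k: "of_nat k * a = 1"
      using of_nat_inverse_CHAR[OF prime_char, of i] i a0 unfolding p_eq by (cases "i = 0") auto
    \<comment> \<open>\<open>b\<^sup>p - b = - a d f\<close>, and division by \<open>- a d\<close> commutes with the \<open>p\<close>-th power\<close>
    define c where "c = - (of_nat (m * k) * b)"
    have "(0 - of_nat (m * k) * b) ^ p = 0 ^ p - of_nat (m * k) * b ^ p"
      unfolding p_eq power_CHAR_diff[OF prime_char] power_CHAR_of_nat_mult[OF prime_char] ..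
    moreover have "c = 0 - of_nat (m * k) * b" unfolding c_def by simp
    ultimately have "c ^ p = 0 ^ p - of_nat (m * k) * b ^ p" by metis
    moreover have "(0 :: 'a) ^ p = 0" using p_gt_1 by simp
    ultimately have cp: "c ^ p = - (of_nat (m * k) * b ^ p)" by (metis diff_0)
    have "c ^ p - c = of_nat (m * k) * (b - b ^ p)"
      unfolding cp by (simp add: c_def algebra_simps)
    also have "b - b ^ p = a * (of_nat d * f)" using b by (simp add: algebra_simps)
    also have "of_nat (m * k) * (a * (of_nat d * f)) = (of_nat m * of_nat d) * (of_nat k * a) * f"
      by (simp add: mult_ac)
    finally have "c ^ p - c = (of_nat m * of_nat d) * (of_nat k * a) * f" .
    then have "c ^ p - c = f" unfolding m k by simp
    moreover have "c \<in> K" unfolding c_def b_def using aK by (intro K.subring_mems)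
    ultimately show False using generator_no_root[OF assms(1)] unfolding f_def by blast
  qed
  then have "\<alpha>' = (\<Sum>j<2. poly.coeff P j * \<alpha> ^ j)"
    using P(3) poly_as_lessThan_sum[of P 2 \<alpha>] unfolding d_def by simp
  then have "\<alpha>' = of_nat i * \<alpha> + poly.coeff P 0"
    using i \<open>d = 1\<close> by (simp add: a_def d_def numeral_2_eq_2)
  moreover have "0 < i" using i a0 by (cases i) auto
  ultimately show ?thesis using i aK by blast
qed

text \<open>
  If \<open>v \<alpha>\<close> were positive, \<open>X\<^sup>p - X - f\<close> would have the simple root \<open>0\<close> modulo the maximal ideal, hence a
  root in \<open>K\<close>.
\<close>

lemma generator_value_le:
  assumes "\<alpha> \<in> S"
  shows "v \<alpha> \<le> 0"
proof (rule ccontr)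
  assume "\<not> v \<alpha> \<le> 0"
  interpret A: subring_set A by (rule A_subring)
  interpret O: subring_set "vge 0" by (rule subring_vge)
  interpret pr: prime_residues A "vge 0" "vgt 0" by (rule prime_residues_valuation)
  define f where "f = \<alpha> ^ p - \<alpha>"
  have \<alpha>: "\<alpha> \<in> vgt 0" using \<open>\<not> v \<alpha> \<le> 0\<close> by (simp add: vgt_def not_le)
  have "\<alpha> ^ (p - 1) \<in> vge 0" using \<alpha> vgt_subset_vge by (intro O.power_mem) auto
  from vgt_mult[OF this \<alpha>] have "\<alpha> ^ p \<in> vgt 0"
    using p_gt_1 power_minus_mult[of p \<alpha>] by simp
  then have fI: "f \<in> vgt 0" unfolding f_def using \<alpha> by (rule vgt_diff)
  then have fA: "f \<in> A" using generator_eq[OF assms] vgt_subset_vge unfolding f_def by auto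
  define g where "g = Polynomial.monom 1 p - [:f, 1:]"
  have g: "g \<in> polys_over A"
    unfolding g_def using fA A.one_mem A.zero_mem
    by (intro A.polys_over_mems) (auto simp: A.polys_over_pCons_iff A.zero_polys_over)
  have dg: "Polynomial.degree g = p"
    unfolding g_def using degree_diff_eq_left[of "[:f, 1:]" "Polynomial.monom 1 p"] p_gt_1
    by (simp add: Polynomial.degree_monom_eq)
  have lead: "Polynomial.lead_coeff g = 1"
    unfolding dg using p_gt_1 by (simp add: g_def coeff_pCons split: nat.split)
  have "poly (pderiv g) 0 = - 1"
    using p_gt_1 by (simp add: g_def pderiv_diff pderiv_monom pderiv_pCons poly_monom p_eq)
  then have "poly (pderiv g) 0 \<notin> vgt 0" using vgt_uminus[of "- 1" 0] not_vgt_self[of 1] by auto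
  moreover have "poly g 0 \<in> vgt 0"
    using vgt_uminus[OF fI] p_gt_1 by (simp add: g_def poly_monom power_0_left)
  ultimately obtain c where c: "c \<in> K" "poly g c = 0"
    using hensel[unfolded henselian_def, rule_format, of 0 g] g lead A.zero_mem A.poly_mem[OF g A.zero_mem]
    by (auto simp: valuation_ring_eq valuation_ideal_eq polys_over_def)
  then have "c ^ p - c = f" by (simp add: g_def poly_monom algebra_simps)
  with generator_no_root[OF assms c(1)] show False unfolding f_def by blast
qed

end

section \<open>Residue degree and ramification index\<close>

context valued_extension
begin

abbreviation "valring \<equiv> ambient\<lparr>carrier := vge 0\<rparr>"
abbreviation "resfield \<equiv> valring Quot vgt 0"
abbreviation "res \<equiv> a_r_coset valring (vgt 0)"

lemma ring_valring: "ring valring" and cring_valring: "cring valring"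
proof -
  interpret field "ambient :: 'a ring" by (rule field_ambient)
  have "subring (vge 0) (ambient :: 'a ring)" using subring_vge subring_set_iff by blast
  then show "ring valring" by (rule subring_is_ring)
  then show "cring valring" 
    by (intro cring.intro comm_monoid.intro comm_monoid_axioms.intro)
      (auto simp: mult.commute ring.is_monoid)
qed

lemma a_inv_valring: "x \<in> vge 0 \<Longrightarrow> a_inv valring x = - x"
proof -
  assume x: "x \<in> vge 0"
  interpret ring valring by (rule ring_valring)
  show ?thesis by (rule minus_equality) (use x vge_uminus in auto)
qed

lemma ideal_vgt: "ideal (vgt 0) valring"
proof (rule idealI[OF ring_valring])
  interpret pr: prime_residues A "vge 0" "vgt 0" by (rule prime_residues_valuation)
  show "subgroup (vgt 0) (add_monoid valring)"
  proof
    fix x assume "x \<in> vgt 0"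
    then have "a_inv valring x \<in> vgt 0"
      using a_inv_valring vgt_uminus pr.I_subset by auto
    then show "m_inv (add_monoid valring) x \<in> vgt 0" by (simp add: a_inv_def)
  qed (use pr.I_subset vgt_add in auto)
  fix a x assume "a \<in> vgt 0" "x \<in> carrier valring"
  then have "x * a \<in> vgt 0" using pr.I_mult by simp
  then show "x \<otimes>\<^bsub>valring\<^esub> a \<in> vgt 0" "a \<otimes>\<^bsub>valring\<^esub> x \<in> vgt 0"
    by (simp_all add: mult.commute)
qed

lemma field_resfield: "field resfield"
proof (rule maximalideal.quotient_is_field[OF maximalidealI cring_valring])
  show "ideal (vgt 0) valring" by (rule ideal_vgt)
  have "1 \<in> vge 0" "1 \<notin> vgt 0" using not_vgt_self[of 1] by (auto simp: vge_def)
  then show "carrier valring \<noteq> vgt 0" by auto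
  fix J assume J: "ideal J valring" "vgt 0 \<subseteq> J" "J \<subseteq> carrier valring"
  interpret J: ideal J valring by fact
  show "J = vgt 0 \<or> J = carrier valring"
  proof (cases "J = vgt 0")
    case False
    then obtain x where x: "x \<in> J" "x \<notin> vgt 0" using J(2) by blast
    then have "x \<noteq> 0" "v x = 0" using J(3) by (auto simp: vge_def vgt_def)
    then have "inverse x \<in> vge 0" by (simp add: vge_def v_inverse)
    then have "inverse x \<otimes>\<^bsub>valring\<^esub> x \<in> J" using x by (intro J.I_l_closed) auto
    then have "\<one>\<^bsub>valring\<^esub> \<in> J" using \<open>x \<noteq> 0\<close> by simp
    then show ?thesis using J.one_imp_carrier by blast
  qed simp
qed

lemma carrier_resfield: "carrier resfield = res ` vge 0"
  by (auto simp: FactRing_def A_RCOSETS_def')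

lemma residue_map_res: "residue_map resfield (vge 0) res"
proof -
  interpret field resfield by (rule field_resfield)
  interpret subring_set "vge 0" by (rule subring_vge)
  show ?thesis
    by unfold_locales (rule ideal.rcos_ring_hom[OF ideal_vgt])
qed

lemma res_eq_zero_iff: "x \<in> vge 0 \<Longrightarrow> res x = \<zero>\<^bsub>resfield\<^esub> \<longleftrightarrow> x \<in> vgt 0"
proof -
  have eq: "res x = (\<lambda>y. y + x) ` vgt 0" by (auto simp: a_r_coset_def')
  have "(\<lambda>y. y + x) ` vgt 0 = vgt 0 \<longleftrightarrow> x \<in> vgt 0"
  proof
    assume "(\<lambda>y. y + x) ` vgt 0 = vgt 0"
    moreover have "0 + x \<in> (\<lambda>y. y + x) ` vgt 0" by (rule imageI) simp
    ultimately show "x \<in> vgt 0" by simp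
  next
    assume x: "x \<in> vgt 0"
    show "(\<lambda>y. y + x) ` vgt 0 = vgt 0"
    proof (intro equalityI subsetI)
      fix z assume "z \<in> vgt 0"
      then have "z - x \<in> vgt 0" using x by (rule vgt_diff)
      then show "z \<in> (\<lambda>y. y + x) ` vgt 0" by (intro image_eqI[of _ _ "z - x"]) auto
    qed (use x vgt_add in auto)
  qed
  then show ?thesis by (simp add: eq FactRing_def)
qed

lemma res_cong:
  assumes "x \<in> vge 0" "y \<in> vge 0" "y - x \<in> vgt 0"
  shows "res y = res x"
proof -
  interpret residue_map resfield "vge 0" res by (rule residue_map_res)
  have "res (x + (y - x)) = res x \<oplus>\<^bsub>resfield\<^esub> res (y - x)"
    using assms by (intro hom_simps) (auto intro: R.diff_mem)
  also have "res (y - x) = \<zero>\<^bsub>resfield\<^esub>"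
    using assms res_eq_zero_iff R.diff_mem by blast
  finally show ?thesis using hom_simps(1)[OF assms(1)] by simp
qed

lemma subfield_res: "subfield (res ` A) resfield"
proof -
  interpret residue_map resfield "vge 0" res by (rule residue_map_res)
  interpret field resfield by (rule field_resfield)
  interpret A: subring_set A by (rule A_subring)
  have a_inv: "\<ominus>\<^bsub>resfield\<^esub> res a = res (- a)" if "a \<in> A" for a
  proof (rule F.minus_equality)
    have "res (- a) \<oplus>\<^bsub>resfield\<^esub> res a = res (- a + a)"
      using that A.uminus_mem by (intro hom_simps(3)[symmetric]) auto
    then show "res (- a) \<oplus>\<^bsub>resfield\<^esub> res a = \<zero>\<^bsub>resfield\<^esub>"
      by (simp add: hom_zero)
    show "res a \<in> carrier resfield" "res (- a) \<in> carrier resfield"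
      using that A.uminus_mem by (auto intro: hom_simps)
  qed
  show ?thesis
  proof (rule subfieldI')
    show "subring (res ` A) resfield"
    proof (rule F.subringI)
      show "res ` A \<subseteq> carrier resfield" by (auto intro: hom_simps)
      show "\<one>\<^bsub>resfield\<^esub> \<in> res ` A" using hom_simps(4) A.one_mem by (metis imageI)
      show "\<ominus>\<^bsub>resfield\<^esub> h \<in> res ` A" if "h \<in> res ` A" for h
        using that a_inv A.uminus_mem by auto
      fix h1 h2 assume "h1 \<in> res ` A" "h2 \<in> res ` A"
      then obtain a b where ab: "a \<in> A" "b \<in> A" "h1 = res a" "h2 = res b" by blast
      then have "h1 \<otimes>\<^bsub>resfield\<^esub> h2 = res (a * b)" "h1 \<oplus>\<^bsub>resfield\<^esub> h2 = res (a + b)"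
        by (simp_all add: hom_simps)
      then show "h1 \<otimes>\<^bsub>resfield\<^esub> h2 \<in> res ` A" "h1 \<oplus>\<^bsub>resfield\<^esub> h2 \<in> res ` A"
        using A.mult_mem A.add_mem ab by blast+
    qed
    fix k assume "k \<in> res ` A - {\<zero>\<^bsub>resfield\<^esub>}"
    then obtain a where a: "a \<in> A" "k = res a" "a \<notin> vgt 0" using res_eq_zero_iff by blast
    then have a': "a \<noteq> 0" "inverse a \<in> A"
      using prime_residues.A_inverse[OF prime_residues_valuation] by auto
    have "m_inv resfield k = res (inverse a)"
    proof (rule comm_inv_char)
      show "k \<otimes>\<^bsub>resfield\<^esub> res (inverse a) = \<one>\<^bsub>resfield\<^esub>"
        using a a' hom_simps(2)[of a "inverse a"] hom_simps(4) by simp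
    qed (use a a' in \<open>auto intro: hom_simps\<close>)
    then show "m_inv resfield k \<in> res ` A" using a' by blast
  qed
qed

text \<open>
  The residues of \<open>1, u, \<dots>, u\<^bsup>n-1\<^esup>\<close> form a basis.
\<close>

lemma residue_degree_eqI:
  assumes "0 < n" "u \<in> vge 0"
    and "\<And>P. P \<in> polys_over A \<Longrightarrow> Polynomial.degree P < n \<Longrightarrow> poly P u \<in> vgt 0 \<Longrightarrow> P \<in> polys_over (vgt 0)"
    and "\<And>x. x \<in> vge 0 \<Longrightarrow> \<exists>P\<in>polys_over A. Polynomial.degree P < n \<and> x - poly P u \<in> vgt 0"
  shows "residue_degree K v v = n"
proof -
  interpret residue_map resfield "vge 0" res by (rule residue_map_res)
  interpret A: subring_set A by (rule A_subring)
  let ?us = "map (\<lambda>i. res (u ^ i)) [0..<n]"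
  have poly_mem: "poly P u \<in> vge 0" if "P \<in> polys_over A" for P
    using that assms(2) polys_over_mono[of A "vge 0"] R.poly_mem by auto
  have "F.independent (res ` A) ?us"
  proof (rule independent_powers[OF _ assms(2) A.subring_set_axioms subfield_res assms(1)])
    fix P i assume P: "P \<in> polys_over A" "Polynomial.degree P < n" "res (poly P u) = \<zero>\<^bsub>resfield\<^esub>"
    then have "poly P u \<in> vgt 0" using res_eq_zero_iff[OF poly_mem] by blast
    then have "poly.coeff P i \<in> vgt 0" using assms(3) P polys_overD by blast
    then show "res (poly.coeff P i) = \<zero>\<^bsub>resfield\<^esub>"
      using res_eq_zero_iff vgt_subset_vge by blast
  qed auto
  moreover have "F.Span (res ` A) ?us = carrier resfield"
  proof -
    have "F.Span (res ` A) ?us = {res (poly P u) | P. P \<in> polys_over A \<and> Polynomial.degree P < n}"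
      using assms A.subring_set_axioms subfield_res by (intro Span_powers) auto
    also have "\<dots> = carrier resfield"
      unfolding carrier_resfield
    proof (intro equalityI subsetI)
      fix y assume "y \<in> res ` vge 0"
      then obtain x where x: "x \<in> vge 0" "y = res x" by blast
      then obtain P where P: "P \<in> polys_over A" "Polynomial.degree P < n" "x - poly P u \<in> vgt 0"
        using assms(4) by blast
      then have "y = res (poly P u)" using res_cong[OF poly_mem x(1)] x(2) by blast
      then show "y \<in> {res (poly P u) | P. P \<in> polys_over A \<and> Polynomial.degree P < n}" using P by blast
    qed (use poly_mem in auto)
    finally show ?thesis .
  qed
  ultimately have "F.dimension n (res ` A) (carrier resfield)"
    using F.dimensionI[OF subfield_res, of ?us "carrier resfield"]
    by (simp only: length_map length_upt diff_zero)
  then have "F.dim (res ` A) (carrier resfield) = n"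
    using F.dimI[OF subfield_res] unfolding over_def by blast
  then show ?thesis
    by (simp add: residue_degree_def residue_field_def base_residues_def valuation_ring_eq valuation_ideal_eq)
qed

lemma value_group_simps:
  "0 \<in> value_group K v"
  "g \<in> value_group K v \<Longrightarrow> h \<in> value_group K v \<Longrightarrow> g - h \<in> value_group K v"
proof -
  show "0 \<in> value_group K v"
    unfolding value_group_def using K.one_mem by (intro image_eqI[of _ _ 1]) auto
  assume "g \<in> value_group K v" "h \<in> value_group K v"
  then obtain x y where "g = v x" "h = v y" "x \<in> K - {0}" "y \<in> K - {0}"
    unfolding value_group_def by blast
  then show "g - h \<in> value_group K v"
    unfolding value_group_def by (intro image_eqI[of _ _ "x / y"]) (auto simp: v_divide K.divide_mem)
qed

lemma value_group_uminus: "g \<in> value_group K v \<Longrightarrow> - g \<in> value_group K v"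
  using value_group_simps(2)[OF value_group_simps(1)] by fastforce

lemma value_group_add: "g \<in> value_group K v \<Longrightarrow> h \<in> value_group K v \<Longrightarrow> g + h \<in> value_group K v"
  using value_group_simps(2)[OF _ value_group_uminus] by fastforce

lemma value_group_nsmul: "g \<in> value_group K v \<Longrightarrow> nsmul n g \<in> value_group K v"
  by (induction n) (auto intro: value_group_add value_group_simps)

text \<open>
  The values \<open>r i\<close> form a system of representatives of the cosets of the value group of \<open>K\<close>.
\<close>

lemma ramification_index_eqI:
  assumes "finite N"
    and distinct: "\<And>i j. i \<in> N \<Longrightarrow> j \<in> N \<Longrightarrow> r i - r j \<in> value_group K v \<Longrightarrow> i = j"
    and attained: "\<And>i. i \<in> N \<Longrightarrow> r i \<in> value_group UNIV v"
    and exhaust: "\<And>g. g \<in> value_group UNIV v \<Longrightarrow> \<exists>i\<in>N. g - r i \<in> value_group K v"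
  shows "ramification_index K v v = card N"
proof -
  let ?coset = "\<lambda>g. (\<lambda>h. h + g) ` value_group K v"
  have coset_eq: "?coset g = ?coset g'" if "g - g' \<in> value_group K v" for g g'
  proof -
    have sub: "?coset g \<subseteq> ?coset g'" if "g - g' \<in> value_group K v" for g g'
    proof
      fix x assume "x \<in> ?coset g"
      then obtain h where h: "h \<in> value_group K v" "x = h + g" by blast
      then show "x \<in> ?coset g'"
        using value_group_add[OF h(1) that] by (intro image_eqI[of _ _ "h + (g - g')"]) auto
    qed
    show ?thesis using sub[OF that] sub[of g' g] value_group_uminus[OF that] by auto
  qed
  have "rcosets\<^bsub>\<lparr>carrier = value_group UNIV v, monoid.mult = (+), one = 0\<rparr>\<^esub> (value_group K v)
      = ?coset ` value_group UNIV v"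
    by (auto simp: RCOSETS_def r_coset_def)
  moreover have "?coset ` value_group UNIV v = (\<lambda>i. ?coset (r i)) ` N"
  proof (intro equalityI subsetI)
    fix C assume "C \<in> ?coset ` value_group UNIV v"
    then obtain g where g: "g \<in> value_group UNIV v" "C = ?coset g" by blast
    obtain i where "i \<in> N" "g - r i \<in> value_group K v" using exhaust[OF g(1)] by blast
    then show "C \<in> (\<lambda>i. ?coset (r i)) ` N" using coset_eq g(2) by blast
  next
    fix C assume "C \<in> (\<lambda>i. ?coset (r i)) ` N"
    then show "C \<in> ?coset ` value_group UNIV v" using attained by blast
  qed
  moreover have "inj_on (\<lambda>i. ?coset (r i)) N"
  proof
    fix i j assume ij: "i \<in> N" "j \<in> N" "?coset (r i) = ?coset (r j)"
    have "0 + r i \<in> ?coset (r i)" by (rule imageI) (rule value_group_simps)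
    then have "0 + r i \<in> ?coset (r j)" unfolding ij(3) .
    then obtain h where h: "h \<in> value_group K v" "0 + r i = h + r j" by blast
    then have "r i - r j = h" by (simp add: algebra_simps)
    then show "i = j" using distinct[OF ij(1,2)] h(1) by simp
  qed
  ultimately show ?thesis
    unfolding ramification_index_def by (simp only: card_image)
qed

end

lemma finite_has_least_value:
  fixes f :: "'b \<Rightarrow> 'c::linorder"
  assumes "finite N" "N \<noteq> {}"
  shows "\<exists>j\<in>N. \<forall>i\<in>N. f j \<le> f i"
proof -
  have "Min (f ` N) \<in> f ` N" using assms by (intro Min_in) auto
  then obtain j where "j \<in> N" "Min (f ` N) = f j" by auto
  then show ?thesis using assms Min_le[of "f ` N"] by (metis finite_imageI imageI)
qed

context artin_schreier_extension
begin

text \<open>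
  The unit \<open>u = t\<alpha>\<close> is not congruent to an element of \<open>A\<close>, because that would give a better approximation
  of \<open>\<alpha>\<close> than \<open>0\<close>. By \<open>powers_independent\<close>, a polynomial in \<open>u\<close> of degree below \<open>p\<close> whose coefficients
  are in \<open>A\<close> and not all in the maximal ideal is a unit. So the value of a polynomial in \<open>u\<close> is the
  least value of its coefficients, which determines both value group and residue field.
\<close>

lemma no_defect_unramified:
  assumes \<alpha>: "\<alpha> \<in> S" and max: "\<And>c. c \<in> K \<Longrightarrow> v (\<alpha> - c) \<le> v \<alpha>"
    and val: "v \<alpha> \<in> value_group K v"
  shows "ramification_index K v v = 1" "residue_degree K v v = p"
proof -
  interpret A: subring_set A by (rule A_subring)
  interpret O: subring_set "vge 0" by (rule subring_vge)
  interpret pr: prime_residues A "vge 0" "vgt 0" by (rule prime_residues_valuation)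
  have \<alpha>0: "\<alpha> \<noteq> 0" "\<alpha> \<notin> K" using generator_notin[OF \<alpha>] K.zero_mem by auto
  obtain t where "t \<in> K - {0}" "- v \<alpha> = v t"
    using value_group_uminus[OF val] unfolding value_group_def by blast
  then have t: "t \<in> K" "t \<noteq> 0" "v t = - v \<alpha>" by auto
  define u where "u = t * \<alpha>"
  have tA: "t \<in> A" using t generator_value_le[OF \<alpha>] by (simp add: vge_def)
  have uv: "v u = 0" "u \<noteq> 0" using t \<alpha>0 by (auto simp: u_def v_mult)
  have uO: "u \<in> vge 0" using uv by (simp add: vge_def)
  have uK: "u \<notin> K"
  proof
    assume "u \<in> K"
    then have "u / t \<in> K" using t K.divide_mem by blast
    then show False using t \<alpha>0 by (simp add: u_def)
  qed
  define b where "b = u ^ p - t ^ (p - 1) * u"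
  have bK: "b \<in> K" unfolding b_def u_def using \<alpha> t(1) by (rule scaled_generator_eq)
  have "b \<in> vge 0" unfolding b_def using uO tA
    by (intro O.diff_mem O.power_mem O.mult_mem) auto
  with bK have bA: "b \<in> A" by simp
  have away: "u - c \<notin> vgt 0" if c: "c \<in> A" for c
  proof
    assume I: "u - c \<in> vgt 0"
    have nz: "u - c \<noteq> 0" using uK c by auto
    have "u - c = t * (\<alpha> - c / t)" using t by (simp add: u_def right_diff_distrib)
    moreover have "\<alpha> - c / t \<noteq> 0" using nz calculation by auto
    ultimately have "v (u - c) = v t + v (\<alpha> - c / t)" using t by (simp add: v_mult)
    moreover have "v (\<alpha> - c / t) \<le> v \<alpha>" using max c t K.divide_mem by blast
    ultimately have "v (u - c) \<le> 0" using t by simp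
    with I nz show False by (auto simp: vgt_def)
  qed
  have indep: "P \<in> polys_over (vgt 0)"
    if "P \<in> polys_over A" "Polynomial.degree P < p" "poly P u \<in> vgt 0" for P
    by (rule pr.powers_independent[OF prime_char p_eq uO away tA t(2) bA _ that]) (simp_all add: b_def)
  have normal_form: "\<exists>m\<in>K. m \<noteq> 0 \<and> v m = v x \<and> (\<exists>P\<in>polys_over A. Polynomial.degree P < p \<and> x = m * poly P u)"
    if x: "x \<noteq> 0" for x
  proof -
    obtain Q where Q: "Q \<in> polys_over K" "Polynomial.degree Q < p" "x = poly Q u"
      using scaled_powers_span[OF uK t(1,2), of x] bK unfolding b_def by blast
    define N where "N = {i. i \<le> Polynomial.degree Q \<and> poly.coeff Q i \<noteq> 0}"
    have "Q \<noteq> 0" using Q x by auto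
    then have "finite N" "Polynomial.degree Q \<in> N" unfolding N_def by auto
    then obtain j where j: "j \<in> N" "\<And>i. i \<in> N \<Longrightarrow> v (poly.coeff Q j) \<le> v (poly.coeff Q i)"
      using finite_has_least_value[of N "\<lambda>i. v (poly.coeff Q i)"] by blast
    define m where "m = poly.coeff Q j"
    have m: "m \<in> K" "m \<noteq> 0" using j(1) polys_overD[OF Q(1)] by (auto simp: m_def N_def)
    define P where "P = Polynomial.smult (inverse m) Q"
    have "poly.coeff P i \<in> A" for i
    proof (cases "poly.coeff Q i = 0")
      case True
      then show ?thesis using A.zero_mem by (simp add: P_def)
    next
      case False
      then have "i \<in> N" unfolding N_def by (simp add: Polynomial.le_degree)
      then show ?thesis
        using j(2) False m polys_overD[OF Q(1)]
        by (auto simp: P_def vge_iff v_mult v_inverse m_def intro!: K.mult_mem K.inverse_mem)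
    qed
    then have P: "P \<in> polys_over A" by (rule polys_overI)
    have degP: "Polynomial.degree P < p" using Q(2) m by (simp add: P_def)
    have "poly.coeff P j = 1" using m by (simp add: P_def m_def)
    then have "P \<notin> polys_over (vgt 0)" using pr.one_notin_I by (metis polys_overD)
    then have "poly P u \<notin> vgt 0" using indep P degP by blast
    moreover have "poly P u \<in> vge 0"
      using P uO polys_over_mono[of A "vge 0"] O.poly_mem by auto
    ultimately have Pu: "poly P u \<noteq> 0" "v (poly P u) = 0" by (auto simp: vge_def vgt_def)
    have xm: "x = m * poly P u" using m Q by (simp add: P_def)
    then have "v m = v x" using Pu m by (simp add: v_mult)
    then show ?thesis using m P degP xm by blast
  qed
  have "ramification_index K v v = card {0::nat}"
  proof (rule ramification_index_eqI[where r = "\<lambda>_. 0"])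
    show "0 \<in> value_group UNIV v"
      unfolding value_group_def by (intro image_eqI[of _ _ 1]) auto
    fix g assume "g \<in> value_group UNIV v"
    then obtain x where x: "x \<noteq> 0" "g = v x" unfolding value_group_def by auto
    then obtain m where "m \<in> K" "m \<noteq> 0" "v m = g" using normal_form[OF x(1)] by blast
    then have "g \<in> value_group K v" unfolding value_group_def by blast
    then show "\<exists>i\<in>{0::nat}. g - 0 \<in> value_group K v" by simp
  qed auto
  then show "ramification_index K v v = 1" by simp
  show "residue_degree K v v = p"
  proof (rule residue_degree_eqI[OF _ uO indep])
    fix x assume x: "x \<in> vge 0"
    show "\<exists>P\<in>polys_over A. Polynomial.degree P < p \<and> x - poly P u \<in> vgt 0"
    proof (cases "x = 0")
      case True
      then show ?thesis using A.zero_polys_over p_gt_1 by (intro bexI[of _ 0]) auto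
    next
      case False
      then obtain m P where m: "m \<in> K" "m \<noteq> 0" "v m = v x"
        and P: "P \<in> polys_over A" "Polynomial.degree P < p" "x = m * poly P u"
        using normal_form[OF False] by blast
      then have "m \<in> A" using x False by (simp add: vge_def)
      then have "Polynomial.smult m P \<in> polys_over A" using P(1) by (rule A.smult_polys_over)
      then show ?thesis using P(2) m(2) unfolding P(3)
        by (intro bexI[of _ "Polynomial.smult m P"]) simp_all
    qed
  qed (use p_gt_1 in auto)
qed

text \<open>
  Since \<open>v \<alpha> < 0\<close>, the multiple \<open>p v \<alpha> = v (\<alpha>\<^sup>p - \<alpha>)\<close> is in the value group of \<open>K\<close>, and \<open>i v \<alpha>\<close> for
  \<open>0 < i < p\<close> is not. The terms of a polynomial in \<open>\<alpha>\<close> of degree below \<open>p\<close> thus have distinct values,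
  and only the constant term can have value \<open>0\<close>.
\<close>

lemma no_defect_ramified:
  assumes \<alpha>: "\<alpha> \<in> S" and val: "v \<alpha> \<notin> value_group K v"
  shows "ramification_index K v v = p" "residue_degree K v v = 1"
proof -
  interpret A: subring_set A by (rule A_subring)
  interpret pr: prime_residues A "vge 0" "vgt 0" by (rule prime_residues_valuation)
  have \<alpha>0: "\<alpha> \<noteq> 0" using generator_notin[OF \<alpha>] K.zero_mem by auto
  let ?g = "v \<alpha>"
  have neg: "?g < 0"
    using generator_value_le[OF \<alpha>] val value_group_simps(1) by (metis order_le_less)
  have p_mult: "nsmul p ?g \<in> value_group K v"
  proof -
    obtain q where q: "p = Suc (Suc q)" using p_gt_1 by (metis One_nat_def Suc_less_eq2 less_imp_Suc_add add_0)
    have "nsmul p ?g < ?g"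
    proof -
      have "nsmul q ?g \<le> 0" using nsmul_mono[of ?g 0 q] neg by simp
      then have "?g + nsmul q ?g < 0" using neg by (rule add_neg_nonpos[rotated])
      then show ?thesis by (simp add: q)
    qed
    then have "- \<alpha> \<in> vgt (v (\<alpha> ^ p))" using \<alpha>0 by (simp add: vgt_def v_power)
    from v_add_eq[OF _ this] have "\<alpha> ^ p - \<alpha> \<noteq> 0" "v (\<alpha> ^ p - \<alpha>) = nsmul p ?g"
      using \<alpha>0 by (auto simp: v_power)
    then show ?thesis
      using generator_eq[OF \<alpha>] unfolding value_group_def by (metis DiffI image_eqI singletonD)
  qed
  have notin: "nsmul i ?g \<notin> value_group K v" if i: "0 < i" "i < p" for i
  proof
    assume *: "nsmul i ?g \<in> value_group K v"
    have "coprime i p" using i p_prime by (metis coprime_commute nat_dvd_not_less prime_imp_coprime_nat)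
    then obtain x y where "i * x = p * y + 1"
      using bezout_nat[of i p] i by (metis coprime_iff_gcd_eq_1 neq0_conv)
    then have "nsmul (x * i) ?g = nsmul (y * p) ?g + ?g"
      by (simp add: mult.commute nsmul_add)
    then have "?g = nsmul x (nsmul i ?g) - nsmul y (nsmul p ?g)"
      by (simp add: nsmul_mult)
    then have "?g \<in> value_group K v"
      using value_group_simps(2) value_group_nsmul * p_mult by metis
    with val show False ..
  qed
  have terms_distinct: "i = j"
    if "i < p" "j < p" "nsmul i ?g - nsmul j ?g \<in> value_group K v" for i j
  proof -
    have *: "i = j" if "i \<le> j" "j < p" "nsmul j ?g - nsmul i ?g \<in> value_group K v" for i j
    proof (rule ccontr)
      assume "i \<noteq> j"
      then have "0 < j - i" "j - i < p" "j = i + (j - i)" using that by auto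
      moreover have "nsmul (i + (j - i)) ?g - nsmul i ?g = nsmul (j - i) ?g" by (simp only: nsmul_add add_diff_cancel_left')
      ultimately show False using notin that(3) by metis
    qed
    show ?thesis
      using *[of i j] *[of j i] that value_group_uminus[OF that(3)] by (cases "i \<le> j") auto
  qed
  have expand: "\<exists>P. P \<in> polys_over K \<and> Polynomial.degree P < p \<and> x = poly P \<alpha> \<and>
      (\<exists>j<p. poly.coeff P j \<noteq> 0 \<and> v x = v (poly.coeff P j) + nsmul j ?g) \<and>
      (\<forall>i. poly.coeff P i * \<alpha> ^ i \<in> vge (v x))" if x: "x \<noteq> 0" for x
  proof -
    obtain P where P: "P \<in> polys_over K" "Polynomial.degree P < p" "x = poly P \<alpha>"
      using generator_powers_span[OF \<alpha>] by blast
    define N where "N = {i. i \<le> Polynomial.degree P \<and> poly.coeff P i \<noteq> 0}"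
    let ?T = "\<lambda>i. v (poly.coeff P i) + nsmul i ?g"
    have "P \<noteq> 0" using P x by auto
    then have N: "finite N" "Polynomial.degree P \<in> N" unfolding N_def by auto
    then obtain j where j: "j \<in> N" "\<And>i. i \<in> N \<Longrightarrow> ?T j \<le> ?T i"
      using finite_has_least_value[of N ?T] by blast
    have vT: "poly.coeff P i * \<alpha> ^ i \<noteq> 0" "v (poly.coeff P i * \<alpha> ^ i) = ?T i" if "i \<in> N" for i
      using that \<alpha>0 by (auto simp: N_def v_mult v_power)
    have strict: "?T j < ?T i" if i: "i \<in> N" "i \<noteq> j" for i
    proof (rule ccontr)
      assume "\<not> ?T j < ?T i"
      then have "?T i = ?T j" using j(2)[OF i(1)] by simp
      then have "nsmul i ?g - nsmul j ?g = v (poly.coeff P j) - v (poly.coeff P i)"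
        by (simp add: algebra_simps)
      moreover have "v (poly.coeff P j) - v (poly.coeff P i) \<in> value_group K v"
        using i j(1) polys_overD[OF P(1)] by (intro value_group_simps) (auto simp: value_group_def N_def)
      ultimately have "i = j" using terms_distinct i j(1) P(2) unfolding N_def by auto
      with i show False by simp
    qed
    have "x = (\<Sum>i\<in>N. poly.coeff P i * \<alpha> ^ i)"
      unfolding P(3) poly_altdef by (rule sum.mono_neutral_right) (auto simp: N_def)
    also have "\<dots> = poly.coeff P j * \<alpha> ^ j + (\<Sum>i\<in>N - {j}. poly.coeff P i * \<alpha> ^ i)"
      using N(1) j(1) by (rule sum.remove)
    finally have xeq: "x = poly.coeff P j * \<alpha> ^ j + (\<Sum>i\<in>N - {j}. poly.coeff P i * \<alpha> ^ i)" .
    have "poly.coeff P i * \<alpha> ^ i \<in> vgt (?T j)" if "i \<in> N - {j}" for i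
      using strict that vT by (auto simp: vgt_def)
    then have rest: "(\<Sum>i\<in>N - {j}. poly.coeff P i * \<alpha> ^ i) \<in> vgt (v (poly.coeff P j * \<alpha> ^ j))"
      unfolding vT(2)[OF j(1)] by (rule vgt_sum)
    have vx: "v x = ?T j"
      using v_add_eq(2)[OF vT(1)[OF j(1)] rest] vT(2)[OF j(1)] xeq by metis
    have ge: "poly.coeff P i * \<alpha> ^ i \<in> vge (v x)" for i
    proof (cases "i \<in> N")
      case True
      then show ?thesis using j(2) vT vx by (simp add: vge_def)
    next
      case False
      then have "poly.coeff P i = 0" unfolding N_def by (auto simp: Polynomial.coeff_eq_0)
      then show ?thesis by simp
    qed
    have "j < p" "poly.coeff P j \<noteq> 0" using j(1) P(2) unfolding N_def by auto
    then show ?thesis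
      by (intro exI[of _ P] conjI exI[of _ j] allI ge P vx)
  qed
  have "ramification_index K v v = card {..<p}"
  proof (rule ramification_index_eqI[where r = "\<lambda>i. nsmul i ?g"])
    fix i show "nsmul i ?g \<in> value_group UNIV v"
      unfolding value_group_def using \<alpha>0 by (intro image_eqI[of _ _ "\<alpha> ^ i"]) (auto simp: v_power)
  next
    fix g assume "g \<in> value_group UNIV v"
    then obtain x where x: "x \<noteq> 0" "g = v x" unfolding value_group_def by auto
    then obtain P j where "P \<in> polys_over K" "j < p" "poly.coeff P j \<noteq> 0" "g = v (poly.coeff P j) + nsmul j ?g"
      using expand by blast
    then show "\<exists>i\<in>{..<p}. g - nsmul i ?g \<in> value_group K v"
      by (intro bexI[of _ j]) (auto simp: value_group_def dest: polys_overD)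
  qed (use terms_distinct in auto)
  then show "ramification_index K v v = p" by simp
  show "residue_degree K v v = 1"
  proof (rule residue_degree_eqI[of 1 1])
    fix P :: "'a poly" assume "Polynomial.degree P < 1" "poly P 1 \<in> vgt 0"
    then show "P \<in> polys_over (vgt 0)"
      by (auto elim!: degree_eq_zeroE intro!: polys_overI simp: coeff_pCons split: nat.split)
  next
    fix x assume x: "x \<in> vge 0"
    have "\<exists>a\<in>A. x - a \<in> vgt 0"
    proof (cases "x = 0")
      case False
      then obtain P where P: "P \<in> polys_over K" "Polynomial.degree P < p" "x = poly P \<alpha>"
        "\<And>i. poly.coeff P i * \<alpha> ^ i \<in> vge (v x)" using expand by blast
      have "0 \<le> v x" using x False by (simp add: vge_def)
      then have ge: "poly.coeff P i * \<alpha> ^ i \<in> vge 0" for i using P(4) vge_mono by blast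
      have gt: "poly.coeff P i * \<alpha> ^ i \<in> vgt 0" if i: "0 < i" "i < p" for i
      proof (cases "poly.coeff P i = 0")
        case False
        have "v (poly.coeff P i * \<alpha> ^ i) \<noteq> 0"
        proof
          assume "v (poly.coeff P i * \<alpha> ^ i) = 0"
          then have "nsmul i ?g = - v (poly.coeff P i)"
            using False \<alpha>0 by (simp add: v_mult v_power eq_neg_iff_add_eq_0 add.commute)
          moreover have "- v (poly.coeff P i) \<in> value_group K v"
            using False polys_overD[OF P(1)] by (intro value_group_uminus) (auto simp: value_group_def)
          ultimately show False using notin[OF i] by simp
        qed
        then show ?thesis using ge[of i] by (auto simp: vge_def vgt_def)
      qed simp
      have "x = (\<Sum>i<p. poly.coeff P i * \<alpha> ^ i)" using P(2,3) poly_as_lessThan_sum by blast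
      also have "\<dots> = poly.coeff P 0 * \<alpha> ^ 0 + (\<Sum>i\<in>{..<p} - {0}. poly.coeff P i * \<alpha> ^ i)"
        using p_gt_1 by (intro sum.remove) auto
      finally have "x - poly.coeff P 0 = (\<Sum>i\<in>{..<p} - {0}. poly.coeff P i * \<alpha> ^ i)" by simp
      also have "\<dots> \<in> vgt 0" by (intro vgt_sum gt) auto
      finally have "x - poly.coeff P 0 \<in> vgt 0" .
      moreover have "poly.coeff P 0 \<in> A" using ge[of 0] polys_overD[OF P(1)] by simp
      ultimately show ?thesis by blast
    next
      case True
      then show ?thesis using A.zero_mem by (intro bexI[of _ 0]) simp_all
    qed
    then obtain a where "a \<in> A" "x - a \<in> vgt 0" by blast
    then show "\<exists>P\<in>polys_over A. Polynomial.degree P < 1 \<and> x - poly P 1 \<in> vgt 0"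
      by (intro bexI[of _ "[:a:]"]) (auto simp: A.polys_over_pCons_iff A.zero_polys_over)
  qed (auto simp: vge_def)
qed

lemma defect_no_best_approximation:
  assumes "has_defect p K v v" "\<alpha> \<in> S" "c \<in> K"
  shows "\<exists>c'\<in>K. v (\<alpha> - c) < v (\<alpha> - c')"
proof (rule ccontr)
  assume "\<not> ?thesis"
  then have le: "v (\<alpha> - c') \<le> v (\<alpha> - c)" if "c' \<in> K" for c' using that by force
  have S: "\<alpha> - c \<in> S" using assms generator_shift by blast
  have "v (\<alpha> - c - c') \<le> v (\<alpha> - c)" if "c' \<in> K" for c'
    using le[OF K.add_mem[OF assms(3) that]] by (simp add: diff_diff_eq)
  then have "ramification_index K v v * residue_degree K v v = p"
    using no_defect_unramified[OF S] no_defect_ramified[OF S] by (cases "v (\<alpha> - c) \<in> value_group K v") auto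
  with assms(1) show False by (simp add: has_defect_def)
qed

end

section \<open>Integral elements\<close>

context subring_set
begin

lemma pcompose_polys_over:
  assumes "P \<in> polys_over R" "Q \<in> polys_over R"
  shows "pcompose P Q \<in> polys_over R"
  using assms(1)
  by (induction P)
    (auto simp: pcompose_pCons polys_over_pCons_iff zero_polys_over
      intro!: add_polys_over mult_polys_over assms(2))

lemma adjoin_eq: "adjoin R x = {poly P x | P. P \<in> polys_over R}"
proof -
  interpret ring "ambient :: 'a ring" by (rule ring_ambient)
  show ?thesis
  proof (intro equalityI subsetI)
    fix y assume "y \<in> adjoin R x"
    then have "y \<in> simple_extension R x" by (simp add: adjoin_def)
    then show "y \<in> {poly P x | P. P \<in> polys_over R}"
    proof (induction rule: simple_extension.induct)
      case zero
      then show ?case using zero_polys_over by (intro CollectI exI[of _ 0]) auto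
    next
      case (lin k1 k2)
      then obtain P where "k1 = poly P x" "P \<in> polys_over R" by blast
      then show ?case using lin
        by (intro CollectI exI[of _ "pCons k2 P"]) (auto simp: polys_over_pCons_iff algebra_simps)
    qed
  next
    fix y assume "y \<in> {poly P x | P. P \<in> polys_over R}"
    then obtain P where P: "y = poly P x" "P \<in> polys_over R" by blast
    have "poly P x \<in> simple_extension R x"
      using P(2)
    proof (induction P)
      case 0
      then show ?case using simple_extension.zero[of R x] by simp
    next
      case (pCons a P)
      then show ?case
        using simple_extension.lin[of "poly P x" R x a]
        by (auto simp: polys_over_pCons_iff algebra_simps)
    qed
    then show "y \<in> adjoin R x" using P by (simp add: adjoin_def)
  qed
qed

lemma char_poly_polys_over:
  assumes M: "M \<in> carrier_mat n n" and entries: "\<And>i j. i < n \<Longrightarrow> j < n \<Longrightarrow> M $$ (i, j) \<in> R"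
  shows "char_poly M \<in> polys_over R"
proof -
  have entry: "char_poly_matrix M $$ (i, j) \<in> polys_over R" if "i < n" "j < n" for i j
    using M entries[OF that] that
    by (auto simp: char_poly_matrix_def polys_over_pCons_iff zero_polys_over one_polys_over
        intro!: add_polys_over uminus_mem one_mem zero_mem)
  have sign: "of_int (sign q) \<in> polys_over R" for q :: "nat \<Rightarrow> nat"
    by (cases "sign q = 1") (auto simp: sign_def one_polys_over intro!: uminus_polys_over one_polys_over)
  have "char_poly_matrix M \<in> carrier_mat n n" using M by simp
  then have "char_poly M = (\<Sum>q | q permutes {0..<n}. of_int (sign q) * (\<Prod>i = 0..<n. char_poly_matrix M $$ (i, q i)))"
    unfolding char_poly_def by (subst det_def') auto
  also have "\<dots> \<in> polys_over R"
    by (intro sum_polys_over mult_polys_over sign prod_polys_over entry)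
      (auto simp: permutes_in_image dest: permutes_in_image)
  finally show ?thesis .
qed

text \<open>
  Let \<open>n\<close> be the degree of \<open>F\<close>. Multiplication by \<open>x\<close> on \<open>1, u, \<dots>, u\<^bsup>n-1\<^esup>\<close> is described by a matrix \<open>M\<close>
  over \<open>R\<close>, whose rows are found by division with remainder by \<open>F\<close>. The vector of these powers is an
  eigenvector of \<open>M\<close> for \<open>x\<close>, so \<open>x\<close> is a root of the characteristic polynomial.
\<close>

lemma adjoin_integral:
  assumes F: "F \<in> polys_over R" "Polynomial.lead_coeff F = 1" "poly F u = 0"
    and x: "x \<in> adjoin R u"
  shows "x \<in> integral_closure R"
proof -
  obtain Q where Q: "Q \<in> polys_over R" "x = poly Q u" using x adjoin_eq by auto
  define n where "n = Polynomial.degree F"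
  have "0 < n"
  proof (rule ccontr)
    assume "\<not> 0 < n"
    then have "F = 1" using F(2) unfolding n_def by (metis coeff_pCons_0 degree_eq_zeroE one_pCons neq0_conv)
    with F show False by simp
  qed
  have F0: "F \<noteq> 0" using F by auto
  define r where "r i = (Q * Polynomial.monom 1 i) mod F" for i
  have r: "r i \<in> polys_over R" "Polynomial.degree (r i) < n" "poly (r i) u = x * u ^ i" for i
  proof -
    have "Q * Polynomial.monom 1 i \<in> polys_over R"
      using Q by (intro mult_polys_over monom_polys_over one_mem)
    then show "r i \<in> polys_over R" unfolding r_def using divmod_monic_polys_over F by blast
    show "Polynomial.degree (r i) < n"
      using Polynomial.degree_mod_less[OF F0, of "Q * Polynomial.monom 1 i"] \<open>0 < n\<close>
      unfolding r_def n_def by auto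
    have "Q * Polynomial.monom 1 i = F * ((Q * Polynomial.monom 1 i) div F) + r i"
      unfolding r_def by simp
    then have "poly (Q * Polynomial.monom 1 i) u = poly (r i) u"
      using F(3) by (metis add_0 mult_zero_left poly_add poly_mult)
    then show "poly (r i) u = x * u ^ i" using Q by (simp add: poly_monom)
  qed
  define M where "M = mat n n (\<lambda>(i, j). poly.coeff (r i) j)"
  define w where "w = vec n (\<lambda>i. u ^ i)"
  have M: "M \<in> carrier_mat n n" unfolding M_def by simp
  have "M *\<^sub>v w = x \<cdot>\<^sub>v w"
  proof (rule eq_vecI)
    fix i assume "i < dim_vec (x \<cdot>\<^sub>v w)"
    then have i: "i < n" by (simp add: w_def)
    have "(M *\<^sub>v w) $ i = (\<Sum>j<n. poly.coeff (r i) j * u ^ j)"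
      using i by (simp add: M_def w_def scalar_prod_def atLeast0LessThan)
    then show "(M *\<^sub>v w) $ i = (x \<cdot>\<^sub>v w) $ i"
      using i r(2,3)[of i] poly_as_lessThan_sum[of "r i" n u] by (simp add: w_def)
  qed (simp add: M_def w_def)
  moreover have "w \<noteq> 0\<^sub>v n"
    using \<open>0 < n\<close> by (auto simp: w_def vec_eq_iff intro!: exI[of _ 0])
  ultimately have "eigenvalue M x"
    unfolding eigenvalue_def eigenvector_def using M by (intro exI[of _ w]) (auto simp: w_def)
  then have "poly (char_poly M) x = 0" using eigenvalue_root_char_poly[OF M] by simp
  moreover have "Polynomial.lead_coeff (char_poly M) = 1" using degree_monic_char_poly[OF M] by simp
  moreover have "char_poly M \<in> polys_over R"
    by (rule char_poly_polys_over[OF M]) (use polys_overD[OF r(1)] in \<open>auto simp: M_def\<close>)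
  ultimately show ?thesis unfolding integral_closure_def polys_over_def by blast
qed

end

context valued_extension
begin

text \<open>
  If \<open>x\<close> has negative value, dividing an integral equation by the highest power of \<open>x\<close> expresses \<open>1\<close> by
  multiples of \<open>x\<^sup>-\<^sup>1\<close>, which lie in the maximal ideal.
\<close>

lemma integral_closure_subset: "integral_closure A \<subseteq> vge 0"
proof
  interpret A: subring_set A by (rule A_subring)
  interpret pr: prime_residues A "vge 0" "vgt 0" by (rule prime_residues_valuation)
  fix x assume "x \<in> integral_closure A"
  then obtain f where f: "Polynomial.lead_coeff f = 1" "f \<in> polys_over A" "poly f x = 0"
    unfolding integral_closure_def polys_over_def by blast
  show "x \<in> vge 0"
  proof (rule ccontr)
    assume "x \<notin> vge 0"
    then have x: "x \<noteq> 0" "v x < 0" by (auto simp: vge_def)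
    define y where "y = inverse x"
    have y: "y \<noteq> 0" "y \<in> vgt 0" using x by (auto simp: y_def vgt_def v_inverse)
    obtain a g where ag: "reflect_poly f = pCons a g" by (metis pCons_cases)
    have a: "a = 1" using f(1) ag coeff_0_reflect_poly[of f] by simp
    have "reflect_poly f \<in> polys_over A"
      using f(2) A.zero_mem by (auto simp: polys_over_def coeff_reflect_poly)
    then have "g \<in> polys_over (vge 0)"
      unfolding ag A.polys_over_pCons_iff using polys_over_mono[of A "vge 0"] by auto
    then have "poly g y \<in> vge 0" using y pr.I_subset by (intro pr.R.poly_mem) auto
    then have gy: "poly g y * y \<in> vgt 0" using pr.I_mult y by blast
    have "poly (reflect_poly f) y = 0"
      using f(3) y(1) by (simp add: poly_reflect_poly_nz y_def)
    then have "1 = - (poly g y * y)" unfolding ag a by (simp add: eq_neg_iff_add_eq_0 mult.commute)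
    then show False using vgt_uminus[OF gy] pr.one_notin_I by metis
  qed
qed

end

section \<open>The filtered union\<close>

locale defect_extension = artin_schreier_extension v K p
  for v :: "'a::field \<Rightarrow> 'g::linordered_ab_group_add" and K p +
  assumes defect: "has_defect p K v v" and generators_nonempty: "AS_generators p K \<noteq> {}"
begin

lemma generator_no_best_approximation: "\<alpha> \<in> S \<Longrightarrow> no_best_approximation v K \<alpha>"
  using generator_notin defect_no_best_approximation[OF defect] by unfold_locales auto

text \<open>
  An approximation \<open>c\<close> of \<open>\<alpha>\<close> that is better than \<open>0\<close> has the value of \<open>\<alpha>\<close>.
\<close>

lemma normalizer_exists:
  assumes "\<alpha> \<in> S"
  shows "\<exists>t. t \<in> K \<and> t \<noteq> 0 \<and> v t = - v \<alpha>"
proof -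
  interpret no_best_approximation v K \<alpha> using assms by (rule generator_no_best_approximation)
  obtain c where c: "c \<in> K" "v (\<alpha> - 0) < v (\<alpha> - c)" using no_max[OF K.zero_mem] by blast
  then have "c \<noteq> 0" "v c = v \<alpha>" using v_diff_closer[OF K.zero_mem c] by auto
  then show ?thesis using c K.inverse_mem by (intro exI[of _ "inverse c"]) (simp add: v_inverse)
qed

definition normalizer :: "'a \<Rightarrow> 'a" where
  "normalizer \<alpha> = (SOME t. t \<in> K \<and> t \<noteq> 0 \<and> v t = - v \<alpha>)"

lemma normalizer:
  assumes "\<alpha> \<in> S"
  shows "normalizer \<alpha> \<in> K" "normalizer \<alpha> \<noteq> 0" "v (normalizer \<alpha>) = - v \<alpha>"
  using someI_ex[OF normalizer_exists[OF assms]] unfolding normalizer_def by auto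

definition prim :: "'a \<Rightarrow> 'a" where "prim \<alpha> = \<alpha> * normalizer \<alpha>"

lemma prim_unit:
  assumes "\<alpha> \<in> S"
  shows "prim \<alpha> \<noteq> 0" "v (prim \<alpha>) = 0"
proof -
  have "\<alpha> \<noteq> 0" using generator_notin[OF assms] K.zero_mem by auto
  then show "prim \<alpha> \<noteq> 0" "v (prim \<alpha>) = 0"
    using normalizer[OF assms] by (auto simp: prim_def v_mult)
qed

text \<open>
  Dividing \<open>\<alpha> = i \<alpha>' + c\<close> by an element of \<open>K\<close> with the value of \<open>\<alpha>\<close> gives \<open>prim \<alpha> = a prim \<alpha>' + b\<close>. Here \<open>a\<close>
  is integral because \<open>v \<alpha> \<le> v \<alpha>'\<close>, and then \<open>b\<close> is integral because everything else is.
\<close>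

lemma prim_chain:
  assumes \<alpha>: "\<alpha> \<in> S" "\<alpha>' \<in> S" and le: "v \<alpha> \<le> v \<alpha>'"
  shows "adjoin A (prim \<alpha>) \<subseteq> adjoin A (prim \<alpha>')"
proof -
  interpret A: subring_set A by (rule A_subring)
  interpret O: subring_set "vge 0" by (rule subring_vge)
  let ?t = "normalizer \<alpha>" and ?t' = "normalizer \<alpha>'"
  note t = normalizer[OF \<alpha>(1)] normalizer[OF \<alpha>(2)]
  obtain i c where i: "c \<in> K" "\<alpha> = of_nat i * \<alpha>' + c"
    using generators_related[OF \<alpha>(2,1)] by blast
  define a where "a = of_nat i * (?t / ?t')"
  define b where "b = ?t * c"
  have eq: "prim \<alpha> = a * prim \<alpha>' + b"
    using t by (simp add: prim_def a_def b_def i(2) field_simps)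
  have "?t / ?t' \<in> vge 0" using t le by (simp add: vge_def v_divide)
  then have aO: "a \<in> vge 0" unfolding a_def by (intro O.mult_mem O.of_nat_mem)
  have "a \<in> K" unfolding a_def using t by (intro K.mult_mem K.of_nat_mem K.divide_mem)
  with aO have aA: "a \<in> A" by simp
  have "prim \<alpha> - a * prim \<alpha>' \<in> vge 0"
    using prim_unit[OF \<alpha>(1)] prim_unit[OF \<alpha>(2)] aO
    by (intro O.diff_mem O.mult_mem) (auto simp: vge_def)
  then have "b \<in> vge 0" using eq by simp
  moreover have "b \<in> K" unfolding b_def using t i by (intro K.mult_mem)
  ultimately have L: "[:b, a:] \<in> polys_over A"
    using aA by (simp add: A.polys_over_pCons_iff A.zero_polys_over)
  have "prim \<alpha> = poly [:b, a:] (prim \<alpha>')" using eq by (simp add: mult.commute)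
  then have "poly P (prim \<alpha>) = poly (pcompose P [:b, a:]) (prim \<alpha>')" for P
    by (simp only: poly_pcompose)
  then show ?thesis
    unfolding A.adjoin_eq using A.pcompose_polys_over[OF _ L] by blast
qed

text \<open>
  Close to \<open>\<alpha>\<close>, the Taylor expansion of \<open>x = P(\<alpha>)\<close> around \<open>c\<close> is dominated by its constant term, so each
  of its terms has a value at least that of \<open>x\<close>.
\<close>

lemma mem_adjoin_prim:
  assumes \<alpha>: "\<alpha> \<in> S" and x: "x \<in> vge 0"
  shows "\<exists>c\<in>K. x \<in> adjoin A (prim (\<alpha> - c))"
proof (cases "x = 0")
  case True
  interpret A: subring_set A by (rule A_subring)
  have "0 \<in> adjoin A (prim (\<alpha> - 0))"
    unfolding A.adjoin_eq using A.zero_polys_over by (intro CollectI exI[of _ 0]) auto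
  then show ?thesis using True K.zero_mem by blast
next
  case False
  interpret A: subring_set A by (rule A_subring)
  interpret no_best_approximation v K \<alpha> using \<alpha> by (rule generator_no_best_approximation)
  obtain P where P: "P \<in> polys_over K" "Polynomial.degree P < p" "x = poly P \<alpha>"
    using generator_powers_span[OF \<alpha>] by blast
  have "P \<noteq> 0" using P False by auto
  then obtain \<beta> where "eventually (\<lambda>c. poly P c \<noteq> 0 \<and> v (poly P c) = \<beta> \<and>
      (\<forall>k\<ge>1. poly (hasse k P) c * (\<alpha> - c) ^ k \<in> vgt \<beta>)) near"
    using eventually_value_constant[of P] P p_eq by blast
  then obtain c where c: "c \<in> K" "poly P c \<noteq> 0" "v (poly P c) = \<beta>"
    "\<And>k. k \<ge> 1 \<Longrightarrow> poly (hasse k P) c * (\<alpha> - c) ^ k \<in> vgt \<beta>"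
    unfolding eventually_near by blast
  define y where "y = \<alpha> - c"
  define t where "t = normalizer y"
  have yS: "y \<in> S" unfolding y_def using \<alpha> c(1) by (rule generator_shift)
  have t: "t \<in> K" "t \<noteq> 0" "v t = - v y" unfolding t_def using normalizer[OF yS] by auto
  have y0: "y \<noteq> 0" using generator_notin[OF yS] K.zero_mem by auto
  let ?d = "Polynomial.degree P"
  have "(\<Sum>k\<in>{1..?d}. poly (hasse k P) c * y ^ k) \<in> vgt (v (poly P c))"
    unfolding c(3) y_def by (intro vgt_sum c(4)) auto
  moreover have "x = poly P c + (\<Sum>k\<in>{1..?d}. poly (hasse k P) c * y ^ k)"
    using taylor_expansion'[of P c y] P(3) by (simp add: y_def)
  ultimately have "v x = \<beta>" using v_add_eq(2)[OF c(2)] c(3) by metis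
  then have \<beta>: "0 \<le> \<beta>" using x False by (simp add: vge_def)
  have summand: "poly (hasse k P) c * y ^ k \<in> vge 0" for k
  proof (cases "k = 0")
    case True
    then show ?thesis using c \<beta> by (simp add: hasse_0 vge_def)
  next
    case False
    then have "poly (hasse k P) c * y ^ k \<in> vgt \<beta>" unfolding y_def by (intro c(4)) simp
    then show ?thesis using vgt_subset_vge vge_mono[OF \<beta>] by blast
  qed
  define Q where "Q = (\<Sum>k\<le>?d. Polynomial.monom (poly (hasse k P) c / t ^ k) k)"
  have "poly (hasse k P) c / t ^ k \<in> A" for k
  proof -
    have "poly (hasse k P) c / t ^ k \<in> K"
      using c(1) t(1) P(1) by (intro K.divide_mem K.power_mem K.poly_mem K.hasse_polys_over)
    moreover have "poly (hasse k P) c / t ^ k \<in> vge 0"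
    proof (cases "poly (hasse k P) c = 0")
      case False
      then have "v (poly (hasse k P) c / t ^ k) = v (poly (hasse k P) c * y ^ k)"
        using t y0 by (simp add: v_mult v_divide v_power nsmul_uminus)
      then show ?thesis using summand[of k] False y0 t by (simp add: vge_def)
    qed simp
    ultimately show ?thesis by simp
  qed
  then have "Q \<in> polys_over A"
    unfolding Q_def by (intro A.sum_polys_over A.monom_polys_over)
  moreover have "x = poly Q (prim y)"
  proof -
    have "poly Q (prim y) = (\<Sum>k\<le>?d. poly (hasse k P) c * y ^ k)"
      unfolding Q_def poly_sum poly_monom prim_def t_def[symmetric]
      using t(2) by (simp add: power_mult_distrib)
    also have "\<dots> = x" using taylor_expansion[of P c y] P(3) by (simp add: y_def)
    finally show ?thesis by simp
  qed
  ultimately show ?thesis unfolding A.adjoin_eq using c(1) y_def by blast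
qed

lemma adjoin_prim_integral:
  assumes \<alpha>: "\<alpha> \<in> S"
  shows "adjoin A (prim \<alpha>) \<subseteq> integral_closure A"
proof
  interpret A: subring_set A by (rule A_subring)
  interpret O: subring_set "vge 0" by (rule subring_vge)
  fix x assume x: "x \<in> adjoin A (prim \<alpha>)"
  let ?t = "normalizer \<alpha>"
  let ?u = "prim \<alpha>"
  note t = normalizer[OF \<alpha>]
  have tA: "?t \<in> A" using t generator_value_le[OF \<alpha>] by (simp add: vge_def)
  define b where "b = ?u ^ p - ?t ^ (p - 1) * ?u"
  have uO: "?u \<in> vge 0" using prim_unit[OF \<alpha>] by (simp add: vge_def)
  have "b \<in> K"
    using scaled_generator_eq[OF \<alpha> t(1)] by (simp add: b_def prim_def mult.commute)
  moreover have "b \<in> vge 0" unfolding b_def using uO tA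
    by (intro O.diff_mem O.power_mem O.mult_mem) auto
  ultimately have bA: "b \<in> A" by simp
  define F where "F = Polynomial.monom 1 p - [:b, ?t ^ (p - 1):]"
  have "F \<in> polys_over A"
    unfolding F_def using bA A.power_mem[OF tA]
    by (intro A.diff_polys_over A.monom_polys_over A.one_mem)
      (simp add: A.polys_over_pCons_iff A.zero_polys_over)
  moreover have "Polynomial.lead_coeff F = 1"
  proof -
    have deg: "Polynomial.degree [:b, ?t ^ (p - 1):] < p"
      using p_gt_1 by (auto simp: degree_pCons_eq_if)
    then have "Polynomial.degree F = p"
      unfolding F_def using degree_diff_eq_left[of "[:b, ?t ^ (p - 1):]" "Polynomial.monom 1 p"]
      by (simp add: Polynomial.degree_monom_eq)
    then show ?thesis using deg by (simp add: F_def Polynomial.coeff_eq_0)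
  qed
  moreover have "poly F ?u = 0" by (simp add: F_def poly_monom b_def)
  ultimately show "x \<in> integral_closure A" using x by (rule A.adjoin_integral)
qed

lemma integral_closure_eq: "integral_closure A = vge 0"
proof
  show "vge 0 \<subseteq> integral_closure A"
  proof
    fix x assume x: "x \<in> vge 0"
    obtain \<alpha> where \<alpha>: "\<alpha> \<in> S" using generators_nonempty by blast
    then obtain c where "c \<in> K" "x \<in> adjoin A (prim (\<alpha> - c))" using mem_adjoin_prim x by blast
    then show "x \<in> integral_closure A" using adjoin_prim_integral generator_shift[OF \<alpha>] by blast
  qed
qed (rule integral_closure_subset)

lemma prim_in_Units:
  assumes "\<alpha> \<in> S"
  shows "prim \<alpha> \<in> Units (ambient\<lparr>carrier := vge 0\<rparr>)"
proof -
  have "prim \<alpha> \<in> vge 0" "inverse (prim \<alpha>) \<in> vge 0"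
    using prim_unit[OF assms] by (auto simp: vge_def v_inverse)
  then show ?thesis
    unfolding Units_def using prim_unit[OF assms] by (auto intro!: bexI[of _ "inverse (prim \<alpha>)"])
qed

end

theorem theorem6p1:
  fixes K :: "'a::field set"
    and v\<^sub>K v\<^sub>L :: "'a \<Rightarrow> 'g::linordered_ab_group_add"
    and p :: nat
  defines "A \<equiv> valuation_ring K v\<^sub>K"
  defines "B \<equiv> integral_closure A"
  defines "S \<equiv> AS_generators p K"
  assumes "subfield K (ambient :: 'a ring)"
    and "CHAR('a) = p" and "p > 0"
    and "valuation_on K v\<^sub>K"
    and "henselian K v\<^sub>K"
    and "artin_schreier p K"
    and "extends_valuation K v\<^sub>K v\<^sub>L"
    and "embeds_in_reals (value_group K v\<^sub>K)"
    and "has_defect p K v\<^sub>K v\<^sub>L"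
  shows "\<exists>prim :: 'a \<Rightarrow> 'a.
    (\<forall>\<alpha>\<in>S. prim \<alpha> \<in> Units (ambient\<lparr>carrier := B\<rparr>) \<inter> {\<alpha> * c | c. c \<in> K - {0}}) \<and>
    B = (\<Union>\<alpha>\<in>S. adjoin A (prim \<alpha>)) \<and>
    (\<forall>\<alpha>\<^sub>1\<in>S. \<forall>\<alpha>\<^sub>2\<in>S. adjoin A (prim \<alpha>\<^sub>1) \<subseteq> adjoin A (prim \<alpha>\<^sub>2) \<or>
                   adjoin A (prim \<alpha>\<^sub>2) \<subseteq> adjoin A (prim \<alpha>\<^sub>1)) \<and>
    (\<forall>\<beta>\<in>B. \<exists>\<alpha>\<in>S. \<beta> \<in> adjoin A (prim \<alpha>))"
proof -
  have prime: "Factorial_Ring.prime CHAR('a)"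
    using assms(5,6) prime_CHAR_semidom[where 'a = 'a] by simp
  have agree: "v\<^sub>L x = v\<^sub>K x" if "x \<in> K" "x \<noteq> 0" for x
    using assms(10) that unfolding extends_valuation_def by blast
  have rings: "valuation_ring K v\<^sub>K = valuation_ring K v\<^sub>L"
    "valuation_ideal K v\<^sub>K = valuation_ideal K v\<^sub>L"
    using agree unfolding valuation_ring_def valuation_ideal_def by (metis (no_types))+
  have groups: "value_group K v\<^sub>K = value_group K v\<^sub>L"
    using agree unfolding value_group_def by (intro image_cong) auto
  have hens: "henselian K v\<^sub>L"
    using assms(8) unfolding henselian_def rings .
  have dim: "ring.dimension ambient p K UNIV" and nonempty: "AS_generators p K \<noteq> {}"
    using assms(9) unfolding artin_schreier_def AS_generators_def by blast+
  have defect: "has_defect p K v\<^sub>L v\<^sub>L"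
    using assms(12) unfolding has_defect_def ramification_index_def residue_degree_def
      base_residues_def rings groups .
  interpret vf: valued_field v\<^sub>L
    using assms(10) by unfold_locales (simp add: extends_valuation_def)
  interpret K: subfield_set K
    using assms(4) by (rule subfield_set_of_subfield)
  interpret D: defect_extension v\<^sub>L K p
    using hens prime dim nonempty defect assms(5) by unfold_locales simp_all
  have A: "A = K \<inter> vf.vge 0"
    unfolding A_def rings vf.valuation_ring_eq ..
  have B: "B = vf.vge 0"
    unfolding B_def A by (rule D.integral_closure_eq)
  have sub: "adjoin A (D.prim \<alpha>) \<subseteq> B" if "\<alpha> \<in> S" for \<alpha>
    using D.adjoin_prim_integral that unfolding S_def A B_def by blast
  have cover: "\<exists>\<alpha>\<in>S. \<beta> \<in> adjoin A (D.prim \<alpha>)" if "\<beta> \<in> B" for \<beta>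
  proof -
    obtain \<alpha> where "\<alpha> \<in> S" using nonempty unfolding S_def by blast
    then show ?thesis
      using D.mem_adjoin_prim[of \<alpha> \<beta>] D.generator_shift that unfolding S_def A B by blast
  qed
  show ?thesis
  proof (intro exI[of _ D.prim] conjI ballI)
    fix \<alpha> assume \<alpha>: "\<alpha> \<in> S"
    then show "D.prim \<alpha> \<in> Units (ambient\<lparr>carrier := B\<rparr>) \<inter> {\<alpha> * c | c. c \<in> K - {0}}"
      using D.prim_in_Units[of \<alpha>] D.normalizer[of \<alpha>] unfolding S_def B D.prim_def by blast
  next
    show "B = (\<Union>\<alpha>\<in>S. adjoin A (D.prim \<alpha>))" using sub cover by blast
  next
    fix \<alpha>\<^sub>1 \<alpha>\<^sub>2 assume "\<alpha>\<^sub>1 \<in> S" "\<alpha>\<^sub>2 \<in> S"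
    then show "adjoin A (D.prim \<alpha>\<^sub>1) \<subseteq> adjoin A (D.prim \<alpha>\<^sub>2) \<or>
        adjoin A (D.prim \<alpha>\<^sub>2) \<subseteq> adjoin A (D.prim \<alpha>\<^sub>1)"
      using D.prim_chain linear[of "v\<^sub>L \<alpha>\<^sub>1" "v\<^sub>L \<alpha>\<^sub>2"] unfolding S_def A by blast
  qed (rule cover)
qed

end
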